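(* Let $r\ge 3$ be an integer and let $\alpha=(A,B,C,D,E,F)$ be a $6$-tuple of pairwise disjoint nonempty finite sets with $r=|A\cup B\cup C|=|D\cup E\cup F|$ and $r+1=|A\cup B\cup D\cup E|$. Let $M_\alpha$ be the matroid on the ground set $A\cup B\cup C\cup D\cup E\cup F$ whose cyclic flats are exactly the following six sets, with the following ranks: $\varnothing$ has rank $0$; $C\cup B\cup E$ has rank $|C|+|B|$; $C\cup A\cup D$ has rank $|C|+|A|$; $F\cup E\cup A$ has rank $|F|+|E|$; $F\cup D\cup B$ has rank $|F|+|D|$; and the ground set $A\cup B\cup C\cup D\cup E\cup F$ has rank $r$. Then: (1) $M_\alpha$ is not base-orderable; (2) each single-element contraction of $M_\alpha$ is transversal; (3) each single-element deletion of $M_\alpha$ is cotransversal; (4) $M_\alpha$ is an excluded minor for each of the following classes of matroids: gammoids, base-orderable matroids, strongly base-orderable matroids, and $k$-base-orderable matroids for any $k\ge 1$.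
   Context: All matroids are finite. A cyclic flat of a matroid $M$ is a flat that is a (possibly empty) union of circuits. A matroid is determined by its ground set together with its cyclic flats and their ranks: with $\mathcal{Z}(M)$ the set of cyclic flats, $r_M(W)=\min\{r_M(Z)+|W-Z| : Z\in\mathcal{Z}(M)\}$ for all $W\subseteq E(M)$. The given data do define a matroid $M_\alpha$. For a positive integer $k$, a $k$-exchange-ordering for bases $B_1,B_2$ of $M$ is a bijection $\sigma : B_1\to B_2$ such that, for every $X\subseteq B_1$ with $|X|\le k$, both $(B_1-X)\cup\sigma(X)$ and $(B_2-\sigma(X))\cup X$ are bases of $M$. A matroid is $k$-base-orderable if each pair of its bases has a $k$-exchange-ordering; base-orderable means $1$-base-orderable. A matroid is strongly base-orderable if for each pair of bases $B_1,B_2$ there is a bijection $\sigma : B_1\to B_2$ such that these two sets are bases for every $X\subseteq B_1$. A gammoid is a minor of a transversal matroid. A matroid is cotransversal if its dual is transversal. An excluded minor for a class is a matroid not in the class all of whose proper minors are in the class. *)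

theory Defs
  imports Main
begin

record 'a pre_matroid =
  ground :: "'a set"
  indeps :: "'a set set"

definition matroid :: "'a pre_matroid \<Rightarrow> bool" where
  "matroid M \<longleftrightarrow>
     finite (ground M) \<and>
     indeps M \<subseteq> Pow (ground M) \<and>
     {} \<in> indeps M \<and>
     (\<forall>I\<in>indeps M. \<forall>J\<subseteq>I. J \<in> indeps M) \<and>
     (\<forall>I\<in>indeps M. \<forall>J\<in>indeps M. card I < card J \<longrightarrow>
        (\<exists>x\<in>J - I. insert x I \<in> indeps M))"

definition basis :: "'a pre_matroid \<Rightarrow> 'a set \<Rightarrow> bool" where
  "basis M B \<longleftrightarrow> B \<in> indeps M \<and> (\<forall>I\<in>indeps M. B \<subseteq> I \<longrightarrow> I = B)"

definition rank :: "'a pre_matroid \<Rightarrow> 'a set \<Rightarrow> nat" where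
  "rank M X = Max (card ` {I \<in> indeps M. I \<subseteq> X})"

definition circuit :: "'a pre_matroid \<Rightarrow> 'a set \<Rightarrow> bool" where
  "circuit M C \<longleftrightarrow>
     C \<subseteq> ground M \<and> C \<notin> indeps M \<and> (\<forall>D. D \<subset> C \<longrightarrow> D \<in> indeps M)"

definition flat :: "'a pre_matroid \<Rightarrow> 'a set \<Rightarrow> bool" where
  "flat M X \<longleftrightarrow>
     X \<subseteq> ground M \<and> (\<forall>x\<in>ground M - X. rank M X < rank M (insert x X))"

definition cyclic_flat :: "'a pre_matroid \<Rightarrow> 'a set \<Rightarrow> bool" where
  "cyclic_flat M X \<longleftrightarrow>
     flat M X \<and> (\<exists>\<C>. (\<forall>C\<in>\<C>. circuit M C) \<and> X = \<Union>\<C>)"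

definition dual :: "'a pre_matroid \<Rightarrow> 'a pre_matroid" where
  "dual M = \<lparr>ground = ground M, indeps = {I. \<exists>B. basis M B \<and> I \<subseteq> ground M - B}\<rparr>"

definition delete :: "'a pre_matroid \<Rightarrow> 'a set \<Rightarrow> 'a pre_matroid" where
  "delete M X = \<lparr>ground = ground M - X, indeps = {I \<in> indeps M. I \<subseteq> ground M - X}\<rparr>"

definition contract :: "'a pre_matroid \<Rightarrow> 'a set \<Rightarrow> 'a pre_matroid" where
  "contract M X = dual (delete (dual M) X)"

definition minor :: "'a pre_matroid \<Rightarrow> 'a pre_matroid \<Rightarrow> bool" where
  "minor N M \<longleftrightarrow>
     (\<exists>X Y. X \<subseteq> ground M \<and> Y \<subseteq> ground M \<and> X \<inter> Y = {} \<and>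
        N = delete (contract M X) Y)"

definition proper_minor :: "'a pre_matroid \<Rightarrow> 'a pre_matroid \<Rightarrow> bool" where
  "proper_minor N M \<longleftrightarrow>
     (\<exists>X Y. X \<subseteq> ground M \<and> Y \<subseteq> ground M \<and> X \<inter> Y = {} \<and> X \<union> Y \<noteq> {} \<and>
        N = delete (contract M X) Y)"

definition isomorphic :: "'a pre_matroid \<Rightarrow> 'b pre_matroid \<Rightarrow> bool" where
  "isomorphic M N \<longleftrightarrow>
     (\<exists>f. bij_betw f (ground M) (ground N) \<and>
        (\<forall>X\<subseteq>ground M. X \<in> indeps M \<longleftrightarrow> f ` X \<in> indeps N))"

definition partial_transversal :: "nat \<Rightarrow> (nat \<Rightarrow> 'a set) \<Rightarrow> 'a set \<Rightarrow> bool" where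
  "partial_transversal n \<A> X \<longleftrightarrow>
     (\<exists>\<phi>. inj_on \<phi> X \<and> (\<forall>x\<in>X. \<phi> x < n \<and> x \<in> \<A> (\<phi> x)))"

text \<open>By the Edmonds--Fulkerson theorem the partial transversals of a family of subsets of a
  finite set always form a matroid, so the matroid axioms are not repeated here.\<close>

definition transversal :: "'a pre_matroid \<Rightarrow> bool" where
  "transversal M \<longleftrightarrow>
     finite (ground M) \<and>
     (\<exists>n \<A>. (\<forall>i<n. \<A> i \<subseteq> ground M) \<and>
        indeps M = {X. X \<subseteq> ground M \<and> partial_transversal n \<A> X})"

definition cotransversal :: "'a pre_matroid \<Rightarrow> bool" where
  "cotransversal M \<longleftrightarrow> matroid M \<and> transversal (dual M)"

text \<open>The transversal matroid may need more elements than the type of the ground set of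
  \<open>M\<close> provides, so it is taken over \<open>nat\<close> and minors are compared up to isomorphism.\<close>

definition gammoid :: "'a pre_matroid \<Rightarrow> bool" where
  "gammoid M \<longleftrightarrow>
     matroid M \<and>
     (\<exists>(N :: nat pre_matroid) N'. transversal N \<and> minor N' N \<and> isomorphic M N')"

definition exchange_ordering ::
    "nat \<Rightarrow> 'a pre_matroid \<Rightarrow> 'a set \<Rightarrow> 'a set \<Rightarrow> ('a \<Rightarrow> 'a) \<Rightarrow> bool" where
  "exchange_ordering k M B\<^sub>1 B\<^sub>2 \<sigma> \<longleftrightarrow>
     bij_betw \<sigma> B\<^sub>1 B\<^sub>2 \<and>
     (\<forall>X\<subseteq>B\<^sub>1. card X \<le> k \<longrightarrow>
        basis M ((B\<^sub>1 - X) \<union> \<sigma> ` X) \<and> basis M ((B\<^sub>2 - \<sigma> ` X) \<union> X))"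

definition k_base_orderable :: "nat \<Rightarrow> 'a pre_matroid \<Rightarrow> bool" where
  "k_base_orderable k M \<longleftrightarrow>
     matroid M \<and>
     (\<forall>B\<^sub>1 B\<^sub>2. basis M B\<^sub>1 \<longrightarrow> basis M B\<^sub>2 \<longrightarrow> (\<exists>\<sigma>. exchange_ordering k M B\<^sub>1 B\<^sub>2 \<sigma>))"

definition base_orderable :: "'a pre_matroid \<Rightarrow> bool" where
  "base_orderable M \<longleftrightarrow> k_base_orderable 1 M"

definition strongly_base_orderable :: "'a pre_matroid \<Rightarrow> bool" where
  "strongly_base_orderable M \<longleftrightarrow>
     matroid M \<and>
     (\<forall>B\<^sub>1 B\<^sub>2. basis M B\<^sub>1 \<longrightarrow> basis M B\<^sub>2 \<longrightarrow>
        (\<exists>\<sigma>. bij_betw \<sigma> B\<^sub>1 B\<^sub>2 \<and>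
           (\<forall>X\<subseteq>B\<^sub>1. basis M ((B\<^sub>1 - X) \<union> \<sigma> ` X) \<and> basis M ((B\<^sub>2 - \<sigma> ` X) \<union> X))))"

definition excluded_minor :: "('a pre_matroid \<Rightarrow> bool) \<Rightarrow> 'a pre_matroid \<Rightarrow> bool" where
  "excluded_minor \<K> M \<longleftrightarrow>
     matroid M \<and> \<not> \<K> M \<and> (\<forall>N. proper_minor N M \<longrightarrow> \<K> N)"

end

theory Submission
  imports Defs
begin

text \<open>The cyclic flats and their ranks determine the independent sets: \<open>W\<close> is independent if and
  only if \<open>|W \<inter> Z| \<le> r(Z)\<close> for the six sets \<open>Z\<close>. So \<open>M\<close> is given by one bound on \<open>|W|\<close> and four
  bounds on the intersections with \<open>C \<union> B \<union> E\<close>, \<open>C \<union> A \<union> D\<close>, \<open>F \<union> E \<union> A\<close> and \<open>F \<union> D \<union> B\<close>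
  (\<open>indep_iff_cyclic_flats\<close>). Likewise the cyclic flats describe the dual
  (\<open>coindep_iff_cyclic_flats\<close>), and the description is that of the matroid of
  \<open>(A, B, C, E, D, F)\<close>. As the dual of a deletion is a contraction of the dual, (3) follows
  from (2).

  For (1), the bases \<open>A \<union> B \<union> C\<close> and \<open>D \<union> E \<union> F\<close> have no exchange bijection: each element of
  \<open>A \<union> B\<close> can only be exchanged for an element of \<open>F\<close>, but \<open>|F| = |A \<union> B| - 1\<close>.

  For (2), let \<open>V1\<close>, \<open>V2\<close>, \<open>V3\<close>, \<open>V4\<close> be the complements of the four flats above. The six parts are
  the pairwise intersections of these sets, like the edges of a complete graph on four
  vertices. By Hall's theorem a family that repeats the four sets \<open>p\<close>, \<open>q\<close>, \<open>s\<close>, \<open>t\<close> times has the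
  partial transversals that are described by a bound on \<open>|W|\<close> and bounds on the four
  \<open>|W - Vi|\<close>, provided that no pairwise intersection is too large
  (\<open>transversal_four_sets\<close>). The bounds that define \<open>M\<close> itself would need multiplicities that
  are inconsistent by one, but contracting an element lowers them so that multiplicities
  exist (\<open>transversal_link\<close>).

  For (4), gammoids are strongly base-orderable (\<open>strongly_base_orderable_if_gammoid\<close>), so by (1)
  \<open>M\<close> belongs to none of the classes, and it suffices that its proper minors are gammoids. By
  (2) and (3) this amounts to minors of transversal matroids and matroids with a transversal
  dual being gammoids. The latter holds because a transversal matroid is a restriction of a
  fundamental one, whose dual is again transversal (\<open>gammoid_if_dual_transversal\<close>).\<close>

section \<open>Bases of a subset\<close>

definition basis_of :: "'a pre_matroid \<Rightarrow> 'a set \<Rightarrow> 'a set \<Rightarrow> bool" where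
  "basis_of M X K \<longleftrightarrow>
     K \<in> indeps M \<and> K \<subseteq> X \<and> (\<forall>I\<in>indeps M. K \<subseteq> I \<longrightarrow> I \<subseteq> X \<longrightarrow> I = K)"

lemma matroid_finite: "matroid M \<Longrightarrow> finite (ground M)"
  by (simp add: matroid_def)

lemma indep_ground: "matroid M \<Longrightarrow> I \<in> indeps M \<Longrightarrow> I \<subseteq> ground M"
  by (auto simp: matroid_def)

lemma indep_finite: "matroid M \<Longrightarrow> I \<in> indeps M \<Longrightarrow> finite I"
  by (meson finite_subset indep_ground matroid_finite)

lemma indep_subset: "matroid M \<Longrightarrow> I \<in> indeps M \<Longrightarrow> J \<subseteq> I \<Longrightarrow> J \<in> indeps M"
  by (auto simp: matroid_def)

lemma empty_indep: "matroid M \<Longrightarrow> {} \<in> indeps M"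
  by (auto simp: matroid_def)

lemma finite_indeps: "matroid M \<Longrightarrow> finite (indeps M)"
  by (meson finite_Pow_iff finite_subset matroid_def)

lemma augment:
  "matroid M \<Longrightarrow> I \<in> indeps M \<Longrightarrow> J \<in> indeps M \<Longrightarrow> card I < card J \<Longrightarrow>
    \<exists>x\<in>J - I. insert x I \<in> indeps M"
  unfolding matroid_def by blast

lemma basis_ofD:
  assumes "basis_of M X K"
  shows "K \<in> indeps M" "K \<subseteq> X" "\<And>I. I \<in> indeps M \<Longrightarrow> K \<subseteq> I \<Longrightarrow> I \<subseteq> X \<Longrightarrow> I = K"
  using assms by (simp_all add: basis_of_def)

lemma augment_to_card:
  assumes "matroid M" "I \<in> indeps M" "J \<in> indeps M" "card I \<le> card J"
  obtains L where "L \<in> indeps M" "I \<subseteq> L" "L \<subseteq> I \<union> J" "card L = card J"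
proof -
  have "\<exists>L\<in>indeps M. I \<subseteq> L \<and> L \<subseteq> I \<union> J \<and> card L = card J"
    using assms(2,4)
  proof (induction "card J - card I" arbitrary: I)
    case 0
    then show ?case by (intro bexI[of _ I]) auto
  next
    case (Suc n)
    then have "card I < card J" by linarith
    from augment[OF assms(1) Suc.prems(1) assms(3) this]
    obtain x where x: "x \<in> J" "x \<notin> I" "insert x I \<in> indeps M" by blast
    have "card (insert x I) = Suc (card I)"
      using x(2) indep_finite[OF assms(1) Suc.prems(1)] by simp
    then have "n = card J - card (insert x I)" "card (insert x I) \<le> card J"
      using Suc.hyps(2) by linarith+
    from Suc.hyps(1)[OF this(1) x(3) this(2)] x(1) show ?case by blast
  qed
  then show thesis using that by blast
qed

lemma basis_of_extend:
  assumes M: "matroid M" and "I \<in> indeps M" "I \<subseteq> X"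
  obtains K where "basis_of M X K" "I \<subseteq> K"
proof -
  let ?S = "{K \<in> indeps M. I \<subseteq> K \<and> K \<subseteq> X}"
  have "finite ?S" "?S \<noteq> {}" using finite_indeps[OF M] assms by auto
  from finite_has_maximal[OF this] obtain K
    where K: "K \<in> ?S" "\<forall>L\<in>?S. K \<subseteq> L \<longrightarrow> K = L" by (elim bexE) (rule that)
  then have "basis_of M X K" unfolding basis_of_def by blast
  then show thesis using K by (intro that[of K]) auto
qed

lemma basis_of_card_max:
  assumes M: "matroid M" and K: "basis_of M X K" and I: "I \<in> indeps M" "I \<subseteq> X"
  shows "card I \<le> card K"
proof (rule ccontr)
  assume c: "\<not> card I \<le> card K"
  then have "card K \<le> card I" by simp
  from augment_to_card[OF M basis_ofD(1)[OF K] I(1) this] obtain L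
    where L: "L \<in> indeps M" "K \<subseteq> L" "L \<subseteq> K \<union> I" "card L = card I" .
  then have "L = K" using basis_ofD(2,3)[OF K] I by (metis Un_least subset_trans)
  then show False using L c by simp
qed

lemma basis_of_if_card:
  assumes M: "matroid M" and K: "basis_of M X K"
    and I: "I \<in> indeps M" "I \<subseteq> X" "card K \<le> card I"
  shows "basis_of M X I"
  unfolding basis_of_def
proof (intro conjI ballI impI)
  fix J assume J: "J \<in> indeps M" "I \<subseteq> J" "J \<subseteq> X"
  then have "card J \<le> card I" using basis_of_card_max[OF M K J(1,3)] I by simp
  then show "J = I" using J indep_finite[OF M J(1)] by (metis card_seteq)
qed (use I in auto)

lemma basis_eq_basis_of: "matroid M \<Longrightarrow> basis M B \<longleftrightarrow> basis_of M (ground M) B"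
  by (auto simp: basis_def basis_of_def dest: indep_ground)

lemma basis_indep: "basis M B \<Longrightarrow> B \<in> indeps M"
  by (simp add: basis_def)

lemma basis_maximal: "basis M B \<Longrightarrow> I \<in> indeps M \<Longrightarrow> B \<subseteq> I \<Longrightarrow> I = B"
  by (simp add: basis_def)

lemma basis_card_max: "matroid M \<Longrightarrow> basis M B \<Longrightarrow> I \<in> indeps M \<Longrightarrow> card I \<le> card B"
  by (rule basis_of_card_max[of M "ground M"]) (simp_all add: basis_eq_basis_of indep_ground)

lemma basis_card_eq: "matroid M \<Longrightarrow> basis M B \<Longrightarrow> basis M B' \<Longrightarrow> card B = card B'"
  using basis_card_max[of M B B'] basis_card_max[of M B' B] basis_indep[of M B] basis_indep[of M B']
  by simp

lemma basis_if_card: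
  assumes "matroid M" "basis M B" "I \<in> indeps M" "card B \<le> card I"
  shows "basis M I"
  using basis_of_if_card[OF assms(1) _ assms(3) indep_ground[OF assms(1,3)] assms(4)] assms(2)
  by (simp add: basis_eq_basis_of[OF assms(1)])

lemma basis_extend:
  assumes "matroid M" "I \<in> indeps M"
  obtains B where "basis M B" "I \<subseteq> B"
proof -
  obtain K where "basis_of M (ground M) K" "I \<subseteq> K"
    using basis_of_extend[OF assms indep_ground[OF assms]] .
  then show thesis using that basis_eq_basis_of[OF assms(1)] by simp
qed

text \<open>Whether \<open>I\<close> stays independent over \<open>X\<close> depends on \<open>X\<close> only and not on the chosen
  basis of \<open>X\<close>: growing \<open>K'\<close> by elements of \<open>I \<union> K\<close> cannot add anything from \<open>X\<close>, so by
  cardinality it adds all of \<open>I\<close>.\<close>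

lemma basis_of_swap:
  assumes M: "matroid M" and K: "basis_of M X K" and K': "basis_of M X K'"
    and I: "I \<union> K \<in> indeps M" "I \<inter> X = {}"
  shows "I \<union> K' \<in> indeps M"
proof -
  have fin: "finite I" "finite K" "finite K'"
    using indep_finite[OF M] I K' by (auto simp: basis_of_def)
  have d: "I \<inter> K = {}" "I \<inter> K' = {}" using I K K' by (auto simp: basis_of_def)
  have cK: "card K = card K'"
    using basis_of_card_max[OF M K] basis_of_card_max[OF M K'] basis_ofD(1,2)[OF K]
      basis_ofD(1,2)[OF K'] by (simp add: order_antisym)
  then have c: "card (I \<union> K) = card (I \<union> K')"
    using d fin by (simp add: card_Un_disjoint)
  then have "card K' \<le> card (I \<union> K)" using fin by (simp add: card_mono)
  then obtain L where L: "L \<in> indeps M" "K' \<subseteq> L" "L \<subseteq> K' \<union> (I \<union> K)" "card L = card (I \<union> K)"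
    using augment_to_card[OF M basis_ofD(1)[OF K'] I(1)] by metis
  have "L \<inter> X \<in> indeps M" using indep_subset[OF M L(1)] by blast
  then have "L \<inter> X = K'" using basis_ofD(2,3)[OF K'] L(2) by blast
  then have "L \<subseteq> I \<union> K'" using L K by (auto simp: basis_of_def)
  then have "L = I \<union> K'" using L c fin by (metis card_subset_eq finite_UnI)
  then show ?thesis using L by simp
qed

lemma rank_eq_card:
  assumes M: "matroid M" and K: "basis_of M X K"
  shows "rank M X = card K"
  unfolding rank_def
proof (rule Max_eqI)
  show "finite (card ` {I \<in> indeps M. I \<subseteq> X})" using finite_indeps[OF M] by auto
qed (use basis_of_card_max[OF M K] K in \<open>auto simp: basis_of_def\<close>)

lemma card_le_rank:
  assumes M: "matroid M" and "I \<in> indeps M" "I \<subseteq> X"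
  shows "card I \<le> rank M X"
proof -
  obtain K where "basis_of M X K" using basis_of_extend[OF assms] .
  then show ?thesis using basis_of_card_max[OF M _ assms(2,3)] rank_eq_card[OF M] by simp
qed

section \<open>Deletion, contraction and duality\<close>

lemma delete_simps [simp]:
  "ground (delete M Y) = ground M - Y"
  "indeps (delete M Y) = {I \<in> indeps M. I \<subseteq> ground M - Y}"
  by (auto simp: delete_def)

lemma dual_simps:
  "ground (dual M) = ground M"
  "indeps (dual M) = {I. \<exists>B. basis M B \<and> I \<subseteq> ground M - B}"
  by (auto simp: dual_def)

lemma delete_delete: "delete (delete M X) Y = delete M (X \<union> Y)"
  by (auto simp: delete_def)

lemma matroid_delete:
  assumes M: "matroid M"
  shows "matroid (delete M Y)"
  unfolding matroid_def
proof (intro conjI ballI allI impI)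
  fix I J assume I: "I \<in> indeps (delete M Y)" and J: "J \<in> indeps (delete M Y)" and "card I < card J"
  then obtain x where "x \<in> J - I" "insert x I \<in> indeps M" using augment[OF M, of I J] by auto
  then show "\<exists>x\<in>J - I. insert x I \<in> indeps (delete M Y)" using I J by auto
qed (use matroid_finite[OF M] empty_indep[OF M] indep_subset[OF M] in auto)

lemma basis_dual_iff:
  assumes M: "matroid M"
  shows "basis (dual M) X \<longleftrightarrow> X \<subseteq> ground M \<and> basis M (ground M - X)"
proof
  assume X: "basis (dual M) X"
  then obtain B where B: "basis M B" "X \<subseteq> ground M - B"
    by (auto simp: basis_def dual_simps)
  then have "ground M - B = X"
    using basis_maximal[OF X, of "ground M - B"] by (auto simp: dual_simps)
  then show "X \<subseteq> ground M \<and> basis M (ground M - X)"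
    using B indep_ground[OF M basis_indep] by (metis Diff_subset double_diff order_refl)
next
  assume X: "X \<subseteq> ground M \<and> basis M (ground M - X)"
  show "basis (dual M) X"
    unfolding basis_def[of "dual M"]
  proof (intro conjI ballI impI)
    show "X \<in> indeps (dual M)" using X by (force simp: dual_simps)
  next
    fix J assume "J \<in> indeps (dual M)" and J: "X \<subseteq> J"
    then obtain B where B: "basis M B" "J \<subseteq> ground M - B" by (auto simp: dual_simps)
    have "B \<subseteq> ground M - X" using indep_ground[OF M basis_indep[OF B(1)]] B J by blast
    then have "ground M - X = B" using basis_maximal[OF B(1) basis_indep] X by blast
    then show "J = X" using B J X by blast
  qed
qed

text \<open>A maximal coindependent subset of the complement of \<open>X\<close> is what a basis \<open>B\<^sub>0\<close> of \<open>M\<close>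
  leaves uncovered there; it is maximal when \<open>B\<^sub>0\<close> wastes as few elements as possible outside
  \<open>X\<close>, that is, when \<open>B\<^sub>0\<close> contains a basis of \<open>X\<close>.\<close>

lemma basis_delete_dual_iff:
  assumes M: "matroid M" and X: "X \<subseteq> ground M"
  shows "basis (delete (dual M) X) B \<longleftrightarrow>
    (\<exists>B\<^sub>0. basis M B\<^sub>0 \<and> basis_of M X (B\<^sub>0 \<inter> X) \<and> B = ground M - X - B\<^sub>0)"
proof -
  have iff: "I \<in> indeps (delete (dual M) X) \<longleftrightarrow>
      I \<subseteq> ground M - X \<and> (\<exists>B\<^sub>0. basis M B\<^sub>0 \<and> I \<subseteq> ground M - B\<^sub>0)" for I
    by (auto simp: dual_simps)
  show ?thesis
  proof
    assume B: "basis (delete (dual M) X) B"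
    obtain B\<^sub>0 where B0: "basis M B\<^sub>0" "B \<subseteq> ground M - X - B\<^sub>0"
      using basis_indep[OF B] unfolding iff by blast
    then have Beq: "B = ground M - X - B\<^sub>0"
      using basis_maximal[OF B, of "ground M - X - B\<^sub>0"] unfolding iff by blast
    note i0 = basis_indep[OF B0(1)]
    have "I = B\<^sub>0 \<inter> X" if I: "I \<in> indeps M" "B\<^sub>0 \<inter> X \<subseteq> I" "I \<subseteq> X" for I
    proof -
      obtain B\<^sub>1 where B1: "B\<^sub>1 \<in> indeps M" "I \<subseteq> B\<^sub>1" "B\<^sub>1 \<subseteq> I \<union> B\<^sub>0" "card B\<^sub>1 = card B\<^sub>0"
        using augment_to_card[OF M I(1) i0 basis_card_max[OF M B0(1) I(1)]] .
      have b1: "basis M B\<^sub>1" using basis_if_card[OF M B0(1) B1(1)] B1 by simp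
      have "B \<subseteq> ground M - X - B\<^sub>1" using B1 I Beq by blast
      then have "ground M - X - B\<^sub>1 = B"
        using basis_maximal[OF B, of "ground M - X - B\<^sub>1"] b1 unfolding iff by blast
      then have "B\<^sub>0 - X \<subseteq> B\<^sub>1" using Beq indep_ground[OF M i0] by blast
      then have "B\<^sub>0 \<subseteq> B\<^sub>1" using B1 I by blast
      then have "B\<^sub>0 = B\<^sub>1" using basis_maximal[OF B0(1) B1(1)] by simp
      then show ?thesis using I B1 by blast
    qed
    then have "basis_of M X (B\<^sub>0 \<inter> X)"
      using indep_subset[OF M i0, of "B\<^sub>0 \<inter> X"] unfolding basis_of_def by blast
    then show "\<exists>B\<^sub>0. basis M B\<^sub>0 \<and> basis_of M X (B\<^sub>0 \<inter> X) \<and> B = ground M - X - B\<^sub>0"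
      using B0 Beq by blast
  next
    assume "\<exists>B\<^sub>0. basis M B\<^sub>0 \<and> basis_of M X (B\<^sub>0 \<inter> X) \<and> B = ground M - X - B\<^sub>0"
    then obtain B\<^sub>0 where B0: "basis M B\<^sub>0" "basis_of M X (B\<^sub>0 \<inter> X)" "B = ground M - X - B\<^sub>0"
      by blast
    show "basis (delete (dual M) X) B"
      unfolding basis_def[of "delete (dual M) X"]
    proof (intro conjI ballI impI)
      show "B \<in> indeps (delete (dual M) X)" using B0 unfolding iff by blast
    next
      fix I assume "I \<in> indeps (delete (dual M) X)" "B \<subseteq> I"
      then obtain B\<^sub>1 where I: "I \<subseteq> ground M - X" "I \<subseteq> ground M - B\<^sub>1" "B \<subseteq> I"
        and B1: "basis M B\<^sub>1" unfolding iff by auto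
      have sub: "B\<^sub>1 - X \<subseteq> B\<^sub>0 - X" using I B0 indep_ground[OF M basis_indep[OF B1]] by blast
      have fin: "finite B\<^sub>0" "finite B\<^sub>1" using indep_finite[OF M basis_indep] B0 B1 by auto
      have "card (B\<^sub>1 \<inter> X) \<le> card (B\<^sub>0 \<inter> X)"
        using basis_of_card_max[OF M B0(2) indep_subset[OF M basis_indep[OF B1] Int_lower1] Int_lower2] .
      moreover have "card B\<^sub>1 = card (B\<^sub>1 \<inter> X) + card (B\<^sub>1 - X)"
        "card B\<^sub>0 = card (B\<^sub>0 \<inter> X) + card (B\<^sub>0 - X)"
        by (rule card_Int_Diff, rule fin)+
      ultimately have "card (B\<^sub>0 - X) \<le> card (B\<^sub>1 - X)"
        using basis_card_eq[OF M B0(1) B1] by simp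
      then have "B\<^sub>1 - X = B\<^sub>0 - X" using card_seteq[OF _ sub] fin by simp
      then show "I = B" using I B0 by blast
    qed
  qed
qed

lemma contract_eq:
  assumes M: "matroid M" and X: "X \<subseteq> ground M" and K: "basis_of M X K"
  shows "contract M X =
    \<lparr>ground = ground M - X, indeps = {I. I \<subseteq> ground M - X \<and> I \<union> K \<in> indeps M}\<rparr>"
proof -
  have "(\<exists>B. basis (delete (dual M) X) B \<and> I \<subseteq> ground M - X - B) \<longleftrightarrow>
      I \<subseteq> ground M - X \<and> I \<union> K \<in> indeps M" for I
  proof
    assume "\<exists>B. basis (delete (dual M) X) B \<and> I \<subseteq> ground M - X - B"
    then obtain B where B: "basis (delete (dual M) X) B" "I \<subseteq> ground M - X - B" by auto
    from B(1) obtain B\<^sub>0 where B0: "basis M B\<^sub>0" "basis_of M X (B\<^sub>0 \<inter> X)"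
      and "B = ground M - X - B\<^sub>0"
      unfolding basis_delete_dual_iff[OF M X] by (elim exE conjE) (rule that)
    then have I: "I \<subseteq> B\<^sub>0 - X" using B(2) by auto
    then have "I \<union> (B\<^sub>0 \<inter> X) \<in> indeps M" "I \<inter> X = {}"
      using I indep_subset[OF M basis_indep[OF B0(1)], of "I \<union> (B\<^sub>0 \<inter> X)"] by auto
    then show "I \<subseteq> ground M - X \<and> I \<union> K \<in> indeps M"
      using basis_of_swap[OF M B0(2) K] B(2) by auto
  next
    assume I: "I \<subseteq> ground M - X \<and> I \<union> K \<in> indeps M"
    then have IK: "I \<union> K \<in> indeps M" by simp
    obtain B\<^sub>0 where B0: "basis M B\<^sub>0" "I \<union> K \<subseteq> B\<^sub>0" using basis_extend[OF M IK] .
    have "B\<^sub>0 \<inter> X \<in> indeps M" using indep_subset[OF M basis_indep[OF B0(1)]] by simp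
    then have "B\<^sub>0 \<inter> X = K" using basis_ofD(3)[OF K] basis_ofD(2)[OF K] B0(2) by simp
    then have "basis (delete (dual M) X) (ground M - X - B\<^sub>0)"
      unfolding basis_delete_dual_iff[OF M X] using B0 K by blast
    then show "\<exists>B. basis (delete (dual M) X) B \<and> I \<subseteq> ground M - X - B"
      using I B0 by blast
  qed
  then show ?thesis unfolding contract_def by (simp add: dual_def delete_def)
qed

lemma ground_contract [simp]: "ground (contract M X) = ground M - X"
  by (simp add: contract_def dual_simps)

lemma indeps_contract_iff:
  assumes "matroid M" "X \<subseteq> ground M" "basis_of M X K"
  shows "I \<in> indeps (contract M X) \<longleftrightarrow> I \<subseteq> ground M - X \<and> I \<union> K \<in> indeps M"
  by (simp add: contract_eq[OF assms])

lemma obtain_basis_of: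
  assumes "matroid M" obtains K where "basis_of M X K"
proof -
  obtain K where "basis_of M X K"
    using basis_of_extend[OF assms empty_indep[OF assms] empty_subsetI] .
  then show thesis using that by simp
qed

lemma matroid_contract:
  assumes M: "matroid M" and X: "X \<subseteq> ground M"
  shows "matroid (contract M X)"
proof -
  obtain K where K: "basis_of M X K" using obtain_basis_of[OF M] .
  note iff = indeps_contract_iff[OF M X K]
  have KX: "K \<subseteq> X" "finite K"
    using basis_ofD(2)[OF K] indep_finite[OF M basis_ofD(1)[OF K]] by simp_all
  have "\<exists>x\<in>J - I. insert x I \<in> indeps (contract M X)"
    if I: "I \<in> indeps (contract M X)" and J: "J \<in> indeps (contract M X)" and c: "card I < card J"
    for I J
  proof -
    have fin: "finite I" "finite J" using I J iff indep_finite[OF M] by auto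
    have "I \<inter> K = {}" "J \<inter> K = {}" using I J iff KX by blast+
    then have "card (I \<union> K) < card (J \<union> K)"
      using fin KX c by (simp add: card_Un_disjoint)
    then obtain x where x: "x \<in> (J \<union> K) - (I \<union> K)" "insert x (I \<union> K) \<in> indeps M"
      using augment[OF M, of "I \<union> K" "J \<union> K"] I J iff by blast
    then show ?thesis using I J by (intro bexI[of _ x]) (auto simp: iff)
  qed
  moreover have "J \<in> indeps (contract M X)" if "I \<in> indeps (contract M X)" "J \<subseteq> I" for I J
    using that indep_subset[OF M, of "I \<union> K" "J \<union> K"] unfolding iff by blast
  moreover have "{} \<in> indeps (contract M X)" using K by (simp add: iff basis_of_def)
  moreover have "finite (ground (contract M X))" "indeps (contract M X) \<subseteq> Pow (ground (contract M X))"
    using matroid_finite[OF M] by (auto simp: iff)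
  ultimately show ?thesis unfolding matroid_def by blast
qed

lemma contract_empty:
  assumes M: "matroid M" shows "contract M {} = M"
proof -
  have "basis_of M {} {}" using empty_indep[OF M] by (auto simp: basis_of_def)
  from contract_eq[OF M _ this] show ?thesis
    using indep_ground[OF M] by (cases M) auto
qed

lemma contract_contract:
  assumes M: "matroid M" and XY: "X \<subseteq> ground M" "Y \<subseteq> ground M" "X \<inter> Y = {}"
  shows "contract (contract M X) Y = contract M (X \<union> Y)"
proof -
  obtain K where K: "basis_of M X K" using obtain_basis_of[OF M] .
  note MX = matroid_contract[OF M XY(1)]
  obtain L where L: "basis_of (contract M X) Y L" using obtain_basis_of[OF MX] .
  note iff = indeps_contract_iff[OF M XY(1) K]
  have Y: "Y \<subseteq> ground (contract M X)" using XY by auto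
  have "basis_of M (X \<union> Y) (L \<union> K)"
    unfolding basis_of_def
  proof (intro conjI ballI impI)
    fix I assume I: "I \<in> indeps M" "L \<union> K \<subseteq> I" "I \<subseteq> X \<union> Y"
    have "I \<inter> X = K" using basis_ofD(2,3)[OF K] I indep_subset[OF M I(1), of "I \<inter> X"] by simp
    then have "(I \<inter> Y) \<union> K = I" using I by blast
    then have "I \<inter> Y \<in> indeps (contract M X)" using I XY by (auto simp: iff)
    then have "I \<inter> Y = L" using basis_ofD(2,3)[OF L] I(2) by simp
    then show "I = L \<union> K" using \<open>(I \<inter> Y) \<union> K = I\<close> by simp
  qed (use L K in \<open>auto simp: basis_of_def iff\<close>)
  note iff' = indeps_contract_iff[OF M _ this]
  have "I \<in> indeps (contract (contract M X) Y) \<longleftrightarrow> I \<in> indeps (contract M (X \<union> Y))" for I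
  proof -
    have "I \<subseteq> ground M - X - Y \<and> I \<union> L \<subseteq> ground M - X \<longleftrightarrow> I \<subseteq> ground M - (X \<union> Y)"
      using XY basis_ofD(2)[OF L] by blast
    moreover have "I \<in> indeps (contract (contract M X) Y) \<longleftrightarrow>
        I \<subseteq> ground M - X - Y \<and> I \<union> L \<subseteq> ground M - X \<and> I \<union> (L \<union> K) \<in> indeps M"
      by (simp only: indeps_contract_iff[OF MX Y L] iff ground_contract Un_assoc)
    moreover have "I \<in> indeps (contract M (X \<union> Y)) \<longleftrightarrow>
        I \<subseteq> ground M - (X \<union> Y) \<and> I \<union> (L \<union> K) \<in> indeps M"
      using XY by (intro iff') simp
    ultimately show ?thesis by argo
  qed
  then have "indeps (contract (contract M X) Y) = indeps (contract M (X \<union> Y))" by blast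
  then show ?thesis by (intro pre_matroid.equality) (auto simp: Diff_eq)
qed

lemma contract_insert:
  assumes "matroid M" "X \<subseteq> ground M" "x \<in> X"
  shows "contract M X = contract (contract M {x}) (X - {x})"
proof -
  have "{x} \<union> (X - {x}) = X" using assms by auto
  moreover have "{x} \<subseteq> ground M" "X - {x} \<subseteq> ground M" "{x} \<inter> (X - {x}) = {}"
    using assms by auto
  from contract_contract[OF assms(1) this]
  have "contract (contract M {x}) (X - {x}) = contract M ({x} \<union> (X - {x}))" .
  ultimately show ?thesis by (simp only:)
qed

lemma contract_single_iff:
  assumes M: "matroid M" and x: "{x} \<in> indeps M"
  shows "I \<in> indeps (contract M {x}) \<longleftrightarrow> I \<subseteq> ground M - {x} \<and> insert x I \<in> indeps M"
  using indeps_contract_iff[OF M, of "{x}" "{x}"] x indep_ground[OF M x]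
  by (auto simp: basis_of_def)

lemma dual_delete_single_iff:
  assumes M: "matroid M" and x: "{x} \<in> indeps (dual M)"
  shows "I \<in> indeps (dual (delete M {x})) \<longleftrightarrow>
    I \<subseteq> ground M - {x} \<and> insert x I \<in> indeps (dual M)"
proof -
  obtain B where B: "basis M B" "x \<notin> B" and xg: "x \<in> ground M" using x by (auto simp: dual_simps)
  have "basis (delete M {x}) B' \<longleftrightarrow> basis M B' \<and> x \<notin> B'" for B'
  proof
    assume "basis M B' \<and> x \<notin> B'"
    then show "basis (delete M {x}) B'" using indep_ground[OF M] by (auto simp: basis_def)
  next
    assume B': "basis (delete M {x}) B'"
    have "B \<in> indeps (delete M {x})" using B basis_indep indep_ground[OF M] by auto
    from basis_card_max[OF matroid_delete[OF M] B' this]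
    show "basis M B' \<and> x \<notin> B'" using basis_if_card[OF M B(1)] basis_indep[OF B'] by auto
  qed
  then show ?thesis using xg by (auto simp: dual_simps)
qed

section \<open>Transversal matroids\<close>

definition matching :: "nat \<Rightarrow> (nat \<Rightarrow> 'a set) \<Rightarrow> ('a \<Rightarrow> nat) \<Rightarrow> 'a set \<Rightarrow> bool" where
  "matching n \<A> \<phi> X \<longleftrightarrow> inj_on \<phi> X \<and> (\<forall>x\<in>X. \<phi> x < n \<and> x \<in> \<A> (\<phi> x))"

lemma partial_transversal_iff: "partial_transversal n \<A> X \<longleftrightarrow> (\<exists>\<phi>. matching n \<A> \<phi> X)"
  by (simp add: partial_transversal_def matching_def)

lemma matching_fun_upd:
  assumes "matching n \<A> \<phi> I" "i < n" "x \<in> \<A> i" "i \<notin> \<phi> ` I"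
  shows "matching n \<A> (\<phi>(x := i)) (insert x I)"
proof -
  have "inj_on (\<phi>(x := i)) (insert x I)"
    using assms(1,4) unfolding matching_def inj_on_def by auto
  then show ?thesis using assms unfolding matching_def by auto
qed

text \<open>Among all matchings of \<open>I\<close>, take one that agrees with \<open>\<psi>\<close> as often as possible. If the index
  \<open>\<psi> j\<close> of a common element \<open>j\<close> were still free, moving \<open>j\<close> to it would increase the agreement.
  So an index that \<open>\<psi>\<close> uses and that is free belongs to an element of \<open>J\<close> outside \<open>I\<close>. This
  replaces the usual argument with alternating paths.\<close>

lemma matching_max_agreement:
  assumes "matching n \<A> \<phi> I" "matching n \<A> \<psi> J" "finite I"
  obtains \<phi>' where "matching n \<A> \<phi>' I" "\<And>j. j \<in> I \<Longrightarrow> j \<in> J \<Longrightarrow> \<psi> j \<in> \<phi>' ` I"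
proof -
  define agree where "agree \<phi> = {x \<in> I \<inter> J. \<phi> x = \<psi> x}" for \<phi>
  have fin: "finite (agree \<phi>)" for \<phi> using assms(3) by (simp add: agree_def)
  have "card (agree \<phi>) < Suc (card I)" for \<phi>
    using card_mono[OF assms(3), of "agree \<phi>"] by (auto simp: agree_def less_Suc_eq_le)
  then have "\<exists>\<phi>'. matching n \<A> \<phi>' I \<and>
      (\<forall>\<chi>. matching n \<A> \<chi> I \<longrightarrow> card (agree \<chi>) \<le> card (agree \<phi>'))"
    using assms(1) by (intro ex_has_greatest_nat[of _ \<phi> _ "Suc (card I)"]) auto
  then obtain \<phi>' where m: "matching n \<A> \<phi>' I"
    and max: "\<And>\<chi>. matching n \<A> \<chi> I \<Longrightarrow> card (agree \<chi>) \<le> card (agree \<phi>')" by auto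
  have "\<psi> j \<in> \<phi>' ` I" if j: "j \<in> I" "j \<in> J" for j
  proof (rule ccontr)
    assume free: "\<psi> j \<notin> \<phi>' ` I"
    have "matching n \<A> (\<phi>'(j := \<psi> j)) (insert j I)"
      using assms(2) j free by (intro matching_fun_upd[OF m]) (auto simp: matching_def)
    then have "matching n \<A> (\<phi>'(j := \<psi> j)) I" using j by (simp add: insert_absorb)
    moreover have "j \<notin> agree \<phi>'" 
      using free imageI[OF j(1), of \<phi>'] by (auto simp: agree_def)
    moreover have "insert j (agree \<phi>') \<subseteq> agree (\<phi>'(j := \<psi> j))"
      using j by (auto simp: agree_def)
    then have "card (insert j (agree \<phi>')) \<le> card (agree (\<phi>'(j := \<psi> j)))"
      by (intro card_mono fin)
    ultimately show False using max[of "\<phi>'(j := \<psi> j)"] fin by simp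
  qed
  then show thesis using m that by simp
qed

lemma partial_transversal_augment:
  assumes I: "partial_transversal n \<A> I" "finite I" and J: "partial_transversal n \<A> J"
    and c: "card I < card J"
  shows "\<exists>x\<in>J - I. partial_transversal n \<A> (insert x I)"
proof -
  obtain \<phi> where "matching n \<A> \<phi> I" using I(1) by (auto simp: partial_transversal_iff)
  moreover obtain \<psi> where \<psi>: "matching n \<A> \<psi> J" using J by (auto simp: partial_transversal_iff)
  ultimately obtain \<phi>' where \<phi>': "matching n \<A> \<phi>' I" "\<And>j. j \<in> I \<Longrightarrow> j \<in> J \<Longrightarrow> \<psi> j \<in> \<phi>' ` I"
    using matching_max_agreement[OF _ _ I(2)] by metis
  have "card (\<psi> ` J) = card J" "card (\<phi>' ` I) = card I"
    using \<psi> \<phi>'(1) by (auto simp: matching_def card_image)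
  then have "\<not> \<psi> ` J \<subseteq> \<phi>' ` I" using c card_mono[of "\<phi>' ` I" "\<psi> ` J"] I(2) by auto
  then obtain j where j: "j \<in> J" "\<psi> j \<notin> \<phi>' ` I" by auto
  then have "j \<notin> I" using \<phi>'(2) by auto
  moreover have "matching n \<A> (\<phi>'(j := \<psi> j)) (insert j I)"
    using \<psi> j by (intro matching_fun_upd[OF \<phi>'(1)]) (auto simp: matching_def)
  ultimately show ?thesis using j by (auto simp: partial_transversal_iff)
qed

lemma matroid_if_transversal:
  assumes "transversal M"
  shows "matroid M"
proof -
  obtain n \<A> where fin: "finite (ground M)"
    and eq: "indeps M = {X. X \<subseteq> ground M \<and> partial_transversal n \<A> X}"
    using assms by (auto simp: transversal_def)
  have sub: "partial_transversal n \<A> J" if I: "partial_transversal n \<A> I" "J \<subseteq> I" for I J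
  proof -
    obtain \<phi> where "matching n \<A> \<phi> I" using I(1) by (auto simp: partial_transversal_iff)
    then have "matching n \<A> \<phi> J" using I(2) by (auto simp: matching_def intro: inj_on_subset)
    then show ?thesis by (auto simp: partial_transversal_iff)
  qed
  have aug: "\<exists>x\<in>J - I. insert x I \<in> indeps M"
    if "I \<in> indeps M" "J \<in> indeps M" "card I < card J" for I J
  proof -
    have "finite I" using that fin by (auto simp: eq intro: finite_subset)
    then show ?thesis
      using partial_transversal_augment[of n \<A> I J] that by (auto simp: eq)
  qed
  have "partial_transversal n \<A> {}" by (auto simp: partial_transversal_iff matching_def)
  then have "{} \<in> indeps M" "indeps M \<subseteq> Pow (ground M)" by (auto simp: eq)
  moreover have "J \<in> indeps M" if "I \<in> indeps M" "J \<subseteq> I" for I J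
    using that sub[of I J] by (auto simp: eq)
  ultimately show ?thesis unfolding matroid_def using fin aug by blast
qed

section \<open>Strong base-orderability of gammoids\<close>

text \<open>A bijection between two bases is read here as a set of directed edges \<open>x \<rightarrow> \<tau> x\<close>, whose
  components are paths from \<open>B\<^sub>1 - B\<^sub>2\<close> to \<open>B\<^sub>2 - B\<^sub>1\<close> and cycles inside \<open>B\<^sub>1 \<inter> B\<^sub>2\<close>. The exchange is
  required to work only for sets \<open>S\<close> that contain with each element all elements of \<open>B\<^sub>1\<close> that
  follow it; otherwise an element of \<open>B\<^sub>1 - S\<close> would be obtained twice. If \<open>\<tau>\<close> fixes \<open>B\<^sub>1 \<inter> B\<^sub>2\<close>, this
  is every subset of \<open>B\<^sub>1\<close>.\<close>

definition path_exchange :: "'a pre_matroid \<Rightarrow> 'a set \<Rightarrow> 'a set \<Rightarrow> ('a \<Rightarrow> 'a) \<Rightarrow> bool" where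
  "path_exchange M B\<^sub>1 B\<^sub>2 \<tau> \<longleftrightarrow> bij_betw \<tau> B\<^sub>1 B\<^sub>2 \<and>
     (\<forall>S\<subseteq>B\<^sub>1. \<tau> ` S \<inter> (B\<^sub>1 - S) = {} \<longrightarrow> (B\<^sub>1 - S) \<union> \<tau> ` S \<in> indeps M)"

text \<open>Two bases have matchings onto the same set of indices: with maximal agreement an index used
  only by \<open>B\<^sub>2\<close> would allow \<open>B\<^sub>1\<close> to be enlarged. Passing from \<open>B\<^sub>1\<close> to \<open>B\<^sub>2\<close> through the common
  indices, one matching can be used outside \<open>S\<close> and the other one on \<open>\<tau> ` S\<close>.\<close>

lemma transversal_path_exchange:
  assumes T: "transversal M" and B1: "basis M B\<^sub>1" and B2: "basis M B\<^sub>2"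
  shows "\<exists>\<tau>. path_exchange M B\<^sub>1 B\<^sub>2 \<tau>"
proof -
  note M = matroid_if_transversal[OF T]
  obtain n \<A> where eq: "indeps M = {X. X \<subseteq> ground M \<and> partial_transversal n \<A> X}"
    using T by (auto simp: transversal_def)
  have fin: "finite B\<^sub>1" "finite B\<^sub>2" using indep_finite[OF M basis_indep] B1 B2 by simp_all
  have g: "B\<^sub>1 \<subseteq> ground M" "B\<^sub>2 \<subseteq> ground M" using indep_ground[OF M basis_indep] B1 B2 by simp_all
  obtain \<phi> where "matching n \<A> \<phi> B\<^sub>1"
    using basis_indep[OF B1] by (auto simp: eq partial_transversal_iff)
  moreover obtain \<psi> where \<psi>: "matching n \<A> \<psi> B\<^sub>2"
    using basis_indep[OF B2] by (auto simp: eq partial_transversal_iff)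
  ultimately obtain \<phi>' where \<phi>': "matching n \<A> \<phi>' B\<^sub>1"
    and ag: "\<And>j. j \<in> B\<^sub>1 \<Longrightarrow> j \<in> B\<^sub>2 \<Longrightarrow> \<psi> j \<in> \<phi>' ` B\<^sub>1"
    using matching_max_agreement[OF _ _ fin(1)] by metis
  have "\<psi> j \<in> \<phi>' ` B\<^sub>1" if j: "j \<in> B\<^sub>2" for j
  proof (rule ccontr)
    assume free: "\<psi> j \<notin> \<phi>' ` B\<^sub>1"
    have "matching n \<A> (\<phi>'(j := \<psi> j)) (insert j B\<^sub>1)"
      using \<psi> j free by (intro matching_fun_upd[OF \<phi>']) (auto simp: matching_def)
    then have "insert j B\<^sub>1 \<in> indeps M" using g j by (auto simp: eq partial_transversal_iff)
    then have "j \<in> B\<^sub>1" using basis_maximal[OF B1, of "insert j B\<^sub>1"] by auto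
    then show False using ag j free by simp
  qed
  then have "\<psi> ` B\<^sub>2 \<subseteq> \<phi>' ` B\<^sub>1" by auto
  moreover have "card (\<phi>' ` B\<^sub>1) \<le> card (\<psi> ` B\<^sub>2)"
    using \<psi> \<phi>' basis_card_eq[OF M B1 B2] by (simp add: matching_def card_image)
  ultimately have im: "\<psi> ` B\<^sub>2 = \<phi>' ` B\<^sub>1" using fin by (intro card_seteq) auto
  define \<tau> where "\<tau> = inv_into B\<^sub>2 \<psi> \<circ> \<phi>'"
  have "bij_betw \<phi>' B\<^sub>1 (\<psi> ` B\<^sub>2)" "bij_betw \<psi> B\<^sub>2 (\<psi> ` B\<^sub>2)"
    using \<phi>' \<psi> im by (simp_all add: matching_def bij_betw_def)
  then have "bij_betw \<phi>' B\<^sub>1 (\<psi> ` B\<^sub>2)" "bij_betw (inv_into B\<^sub>2 \<psi>) (\<psi> ` B\<^sub>2) B\<^sub>2"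
    by (simp_all add: bij_betw_inv_into)
  then have bij: "bij_betw \<tau> B\<^sub>1 B\<^sub>2" unfolding \<tau>_def by (rule bij_betw_trans)
  have \<psi>\<tau>: "\<psi> (\<tau> x) = \<phi>' x" if "x \<in> B\<^sub>1" for x
    unfolding \<tau>_def comp_def using that im by (intro f_inv_into_f) auto
  have \<tau>B: "\<tau> x \<in> B\<^sub>2" if "x \<in> B\<^sub>1" for x using bij that by (auto simp: bij_betw_def)
  have "(B\<^sub>1 - S) \<union> \<tau> ` S \<in> indeps M" if S: "S \<subseteq> B\<^sub>1" "\<tau> ` S \<inter> (B\<^sub>1 - S) = {}" for S
  proof -
    define \<chi> where "\<chi> x = (if x \<in> B\<^sub>1 - S then \<phi>' x else \<psi> x)" for x
    have \<chi>: "\<And>x. x \<in> B\<^sub>1 - S \<Longrightarrow> \<chi> x = \<phi>' x" "\<And>x. x \<notin> B\<^sub>1 - S \<Longrightarrow> \<chi> x = \<psi> x"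
      by (auto simp: \<chi>_def)
    have inj: "inj_on \<phi>' B\<^sub>1" "inj_on \<psi> B\<^sub>2" using \<phi>' \<psi> by (auto simp: matching_def)
    have "inj_on \<chi> (B\<^sub>1 - S)"
      using inj_on_subset[OF inj(1), of "B\<^sub>1 - S"] \<chi>(1) by (auto simp: inj_on_def)
    moreover have nS: "y \<notin> B\<^sub>1 - S" if "y \<in> \<tau> ` S" for y using S that by auto
    have "inj_on \<chi> (\<tau> ` S)"
    proof (rule inj_onI)
      fix x y assume xy: "x \<in> \<tau> ` S" "y \<in> \<tau> ` S" "\<chi> x = \<chi> y"
      then have "\<psi> x = \<psi> y" "x \<in> B\<^sub>2" "y \<in> B\<^sub>2" using \<chi>(2)[OF nS] S(1) \<tau>B by auto
      then show "x = y" using inj_onD[OF inj(2)] by simp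
    qed
    moreover have "\<chi> x \<noteq> \<chi> y" if x: "x \<in> B\<^sub>1 - S" and y: "y \<in> \<tau> ` S" for x y
    proof -
      obtain s where s: "s \<in> S" "y = \<tau> s" using y by auto
      have "\<chi> y = \<phi>' s" using \<chi>(2)[OF nS[OF y]] \<psi>\<tau>[of s] s S by auto
      moreover have "\<chi> x = \<phi>' x" "x \<noteq> s" using \<chi>(1)[OF x] x s by auto
      ultimately show ?thesis using inj_onD[OF inj(1), of x s] x s S by auto
    qed
    ultimately have "inj_on \<chi> ((B\<^sub>1 - S) \<union> \<tau> ` S)"
      unfolding inj_on_Un by blast
    moreover have "\<chi> x < n \<and> x \<in> \<A> (\<chi> x)" if "x \<in> (B\<^sub>1 - S) \<union> \<tau> ` S" for x
      using that \<phi>' \<psi> \<tau>B S(1) by (auto simp: matching_def \<chi>_def)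
    ultimately have "matching n \<A> \<chi> ((B\<^sub>1 - S) \<union> \<tau> ` S)" by (auto simp: matching_def)
    then show ?thesis using g \<tau>B S(1) by (auto simp: eq partial_transversal_iff)
  qed
  then show ?thesis using bij unfolding path_exchange_def by blast
qed

text \<open>A common element \<open>z\<close> of the two bases can be taken out of its path by short-cutting
  \<open>w \<rightarrow> z \<rightarrow> \<tau> z\<close> to \<open>w \<rightarrow> \<tau> z\<close>. Exchanging \<open>S\<close> along the new edges gives the same set as exchanging
  along the old ones the set that treats \<open>z\<close> in the same way as its predecessor \<open>w\<close>.\<close>

lemma path_exchange_bypass:
  assumes p: "path_exchange M B\<^sub>1 B\<^sub>2 \<tau>" and z: "z \<in> B\<^sub>1" "z \<in> B\<^sub>2" "\<tau> z \<noteq> z"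
  obtains \<tau>' where "path_exchange M B\<^sub>1 B\<^sub>2 \<tau>'" "\<tau>' z = z" "\<forall>x\<in>B\<^sub>1. \<tau> x = x \<longrightarrow> \<tau>' x = x"
proof -
  have bij: "bij_betw \<tau> B\<^sub>1 B\<^sub>2" and ex: "\<And>S. S \<subseteq> B\<^sub>1 \<Longrightarrow> \<tau> ` S \<inter> (B\<^sub>1 - S) = {} \<Longrightarrow> (B\<^sub>1 - S) \<union> \<tau> ` S \<in> indeps M"
    using p by (simp_all add: path_exchange_def)
  obtain w where w: "w \<in> B\<^sub>1" "\<tau> w = z" using bij z by (auto simp: bij_betw_def)
  have wz: "w \<noteq> z" using w z by auto
  have inj: "\<tau> x = \<tau> y \<longleftrightarrow> x = y" if "x \<in> B\<^sub>1" "y \<in> B\<^sub>1" for x y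
    using bij that by (auto simp: bij_betw_def inj_on_def)
  define \<tau>' where "\<tau>' x = (if x = z then z else if x = w then \<tau> z else \<tau> x)" for x
  have t: "\<tau>' z = z" "\<tau>' w = \<tau> z" "\<And>x. x \<noteq> z \<Longrightarrow> x \<noteq> w \<Longrightarrow> \<tau>' x = \<tau> x"
    using wz by (auto simp: \<tau>'_def)
  have im: "\<tau>' ` (S - {z, w}) = \<tau> ` (S - {z, w})" for S using t(3) by (intro image_cong) auto
  have "\<tau>' ` B\<^sub>1 = \<tau>' ` (B\<^sub>1 - {z, w}) \<union> {\<tau>' z, \<tau>' w}" using z w by blast
  also have "\<dots> = \<tau> ` (B\<^sub>1 - {z, w}) \<union> {\<tau> z, \<tau> w}" using im t w by auto
  also have "\<dots> = \<tau> ` B\<^sub>1" using z w by blast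
  finally have "\<tau>' ` B\<^sub>1 = B\<^sub>2" using bij by (simp add: bij_betw_def)
  moreover have "inj_on \<tau>' B\<^sub>1"
    using inj z w wz by (intro inj_onI) (auto simp: \<tau>'_def split: if_splits)
  ultimately have bij': "bij_betw \<tau>' B\<^sub>1 B\<^sub>2" by (simp add: bij_betw_def)
  have "(B\<^sub>1 - S) \<union> \<tau>' ` S \<in> indeps M" if S: "S \<subseteq> B\<^sub>1" "\<tau>' ` S \<inter> (B\<^sub>1 - S) = {}" for S
  proof (cases "w \<in> S")
    case True
    let ?S = "insert z S"
    have *: "\<tau> ` ?S = \<tau>' ` (S - {z, w}) \<union> {z, \<tau> z}" unfolding im using True w by blast
    have "\<tau>' ` S \<union> {z} = \<tau>' ` (S \<union> {z})" using t(1) by simp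
    also have "S \<union> {z} = (S - {z, w}) \<union> {z, w}" using True by blast
    finally have **: "\<tau>' ` S \<union> {z} = \<tau>' ` (S - {z, w}) \<union> {z, \<tau> z}"
      using t(1,2) by (simp add: image_Un)
    have TU: "\<tau> ` ?S = insert z (\<tau>' ` S)" using * ** by simp
    have "insert z (\<tau>' ` S) \<inter> (B\<^sub>1 - ?S) = {}" using S(2) by fastforce
    then have "(B\<^sub>1 - ?S) \<union> insert z (\<tau>' ` S) \<in> indeps M"
      using ex[of ?S] S(1) z(1) unfolding TU by simp
    moreover have "z \<in> S \<Longrightarrow> z \<in> \<tau>' ` S" using t(1) by force
    then have "(B\<^sub>1 - ?S) \<union> insert z (\<tau>' ` S) = (B\<^sub>1 - S) \<union> \<tau>' ` S"
      using z(1) by (cases "z \<in> S") (simp_all add: insert_absorb, fastforce)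
    ultimately show ?thesis by simp
  next
    case False
    let ?S = "S - {z}"
    have *: "\<tau> ` ?S = \<tau>' ` (S - {z, w})" unfolding im using False by blast
    have "\<tau>' ` S \<union> {z} = \<tau>' ` (S \<union> {z})" using t(1) by simp
    also have "S \<union> {z} = (S - {z, w}) \<union> {z}" using False by blast
    finally have **: "\<tau>' ` S \<union> {z} = \<tau>' ` (S - {z, w}) \<union> {z}"
      using t(1) by (simp add: image_Un)
    have nz: "z \<notin> \<tau> ` ?S"
    proof
      assume "z \<in> \<tau> ` ?S"
      then obtain s where "s \<in> S" "\<tau> s = z" by auto
      then show False using inj[of s w] S(1) w False by auto
    qed
    then have "\<tau> ` ?S = (\<tau> ` ?S \<union> {z}) - {z}" by simp
    also have "\<dots> = (\<tau>' ` S \<union> {z}) - {z}" using * ** by simp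
    finally have TU: "\<tau> ` ?S = \<tau>' ` S - {z}" by simp
    have "(\<tau>' ` S - {z}) \<inter> (B\<^sub>1 - ?S) = {}" using S(2) unfolding disjoint_iff by blast
    then have "(B\<^sub>1 - ?S) \<union> (\<tau>' ` S - {z}) \<in> indeps M"
      using ex[of ?S] S(1) unfolding TU by auto
    moreover have "z \<in> S \<longleftrightarrow> z \<in> \<tau>' ` S"
    proof
      assume "z \<in> \<tau>' ` S"
      then show "z \<in> S" using S(2) z(1) by auto
    qed (use t(1) in force)
    then have "(B\<^sub>1 - ?S) \<union> (\<tau>' ` S - {z}) = (B\<^sub>1 - S) \<union> \<tau>' ` S"
      using z(1) by (cases "z \<in> S") (simp_all, fastforce)
    ultimately show ?thesis by simp
  qed
  then have "path_exchange M B\<^sub>1 B\<^sub>2 \<tau>'" using bij' unfolding path_exchange_def by blast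
  moreover have "\<tau>' x = x" if "x \<in> B\<^sub>1" "\<tau> x = x" for x
    using that wz w by (auto simp: \<tau>'_def)
  ultimately show thesis using t(1) that by simp
qed

text \<open>A path exchange with as many fixed points as possible admits no further short-cut.\<close>

lemma path_exchange_fixing:
  assumes p: "path_exchange M B\<^sub>1 B\<^sub>2 \<tau>" and fin: "finite B\<^sub>1"
  obtains \<sigma> where "path_exchange M B\<^sub>1 B\<^sub>2 \<sigma>" "\<And>x. x \<in> B\<^sub>1 \<Longrightarrow> x \<in> B\<^sub>2 \<Longrightarrow> \<sigma> x = x"
proof -
  define fixed where "fixed \<tau> = {x \<in> B\<^sub>1. \<tau> x = x}" for \<tau>
  have ff: "finite (fixed \<tau>)" for \<tau> using fin by (simp add: fixed_def)
  have "card (fixed \<tau>) < Suc (card B\<^sub>1)" for \<tau>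
    using card_mono[OF fin, of "fixed \<tau>"] by (auto simp: fixed_def less_Suc_eq_le)
  then have "\<exists>\<sigma>. path_exchange M B\<^sub>1 B\<^sub>2 \<sigma> \<and>
      (\<forall>\<chi>. path_exchange M B\<^sub>1 B\<^sub>2 \<chi> \<longrightarrow> card (fixed \<chi>) \<le> card (fixed \<sigma>))"
    using p by (intro ex_has_greatest_nat[of _ \<tau> _ "Suc (card B\<^sub>1)"]) auto
  then obtain \<sigma> where s: "path_exchange M B\<^sub>1 B\<^sub>2 \<sigma>"
    and max: "\<And>\<chi>. path_exchange M B\<^sub>1 B\<^sub>2 \<chi> \<Longrightarrow> card (fixed \<chi>) \<le> card (fixed \<sigma>)" by auto
  have "\<sigma> x = x" if x: "x \<in> B\<^sub>1" "x \<in> B\<^sub>2" for x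
  proof (rule ccontr)
    assume nx: "\<sigma> x \<noteq> x"
    obtain \<sigma>' where s': "path_exchange M B\<^sub>1 B\<^sub>2 \<sigma>'" "\<sigma>' x = x"
      "\<forall>y\<in>B\<^sub>1. \<sigma> y = y \<longrightarrow> \<sigma>' y = y"
      using path_exchange_bypass[OF s x nx] .
    have "insert x (fixed \<sigma>) \<subseteq> fixed \<sigma>'" using s' x by (auto simp: fixed_def)
    then have "card (insert x (fixed \<sigma>)) \<le> card (fixed \<sigma>')" by (intro card_mono ff)
    moreover have "x \<notin> fixed \<sigma>" using nx by (simp add: fixed_def)
    ultimately show False using max[OF s'(1)] ff by simp
  qed
  then show thesis using s that by simp
qed

lemma strongly_base_orderable_if_transversal:
  assumes T: "transversal M"
  shows "strongly_base_orderable M"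
  unfolding strongly_base_orderable_def
proof (intro conjI allI impI)
  show M: "matroid M" using T by (rule matroid_if_transversal)
  fix B\<^sub>1 B\<^sub>2 assume B1: "basis M B\<^sub>1" and B2: "basis M B\<^sub>2"
  have fin: "finite B\<^sub>1" by (rule indep_finite[OF M basis_indep[OF B1]])
  obtain \<tau> where "path_exchange M B\<^sub>1 B\<^sub>2 \<tau>" using transversal_path_exchange[OF T B1 B2] by auto
  then obtain \<sigma> where s: "path_exchange M B\<^sub>1 B\<^sub>2 \<sigma>" and fx: "\<And>x. x \<in> B\<^sub>1 \<Longrightarrow> x \<in> B\<^sub>2 \<Longrightarrow> \<sigma> x = x"
    using path_exchange_fixing[OF _ fin] by metis
  have bij: "bij_betw \<sigma> B\<^sub>1 B\<^sub>2" and inj: "inj_on \<sigma> B\<^sub>1" and im: "\<sigma> ` B\<^sub>1 = B\<^sub>2"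
    using s by (simp_all add: path_exchange_def bij_betw_def)
  have ex: "basis M ((B\<^sub>1 - S) \<union> \<sigma> ` S)" if S: "S \<subseteq> B\<^sub>1" for S
  proof -
    have d: "\<sigma> ` S \<inter> (B\<^sub>1 - S) = {}"
    proof (rule ccontr)
      assume "\<sigma> ` S \<inter> (B\<^sub>1 - S) \<noteq> {}"
      then obtain x where x: "x \<in> S" "\<sigma> x \<in> B\<^sub>1 - S" by auto
      then have "\<sigma> (\<sigma> x) = \<sigma> x" using fx[of "\<sigma> x"] im S by auto
      then have "\<sigma> x = x" using inj_onD[OF inj] x S by auto
      then show False using x by simp
    qed
    then have i: "(B\<^sub>1 - S) \<union> \<sigma> ` S \<in> indeps M" using s S by (simp add: path_exchange_def)
    have fS: "finite S" using S fin by (rule finite_subset)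
    have "card ((B\<^sub>1 - S) \<union> \<sigma> ` S) = card (B\<^sub>1 - S) + card (\<sigma> ` S)"
      using d fin fS by (intro card_Un_disjoint) auto
    also have "\<dots> = card (B\<^sub>1 - S) + card S"
      using inj_on_subset[OF inj S] by (simp add: card_image)
    also have "\<dots> = card B\<^sub>1" using S fS fin by (simp add: card_Diff_subset card_mono)
    finally show ?thesis using basis_if_card[OF M B1 i] by simp
  qed
  have "basis M ((B\<^sub>2 - \<sigma> ` X) \<union> X)" if X: "X \<subseteq> B\<^sub>1" for X
  proof -
    have "(B\<^sub>1 - (B\<^sub>1 - X)) \<union> \<sigma> ` (B\<^sub>1 - X) = (B\<^sub>2 - \<sigma> ` X) \<union> X"
      using X im inj_on_image_set_diff[OF inj, of B\<^sub>1 X] by auto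
    then show ?thesis using ex[of "B\<^sub>1 - X"] by auto
  qed
  then show "\<exists>\<sigma>. bij_betw \<sigma> B\<^sub>1 B\<^sub>2 \<and>
      (\<forall>X\<subseteq>B\<^sub>1. basis M ((B\<^sub>1 - X) \<union> \<sigma> ` X) \<and> basis M ((B\<^sub>2 - \<sigma> ` X) \<union> X))"
    using bij ex by (intro exI[of _ \<sigma>]) simp
qed

text \<open>Bases of a minor or of an isomorphic copy \<open>N\<close> are, after renaming by \<open>g\<close>, the bases of \<open>M\<close>
  that contain a fixed set \<open>K\<close> and no other element outside \<open>N\<close>. An exchange bijection fixes
  \<open>K\<close>, because exchanging a single element for another element of the same basis would shrink
  the basis; so it restricts to \<open>N\<close>.\<close>

lemma strongly_base_orderable_embed:
  assumes S: "strongly_base_orderable M" and N: "matroid N"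
    and inj: "inj_on g (ground N)" and K: "K \<inter> g ` ground N = {}"
    and b: "\<And>B. B \<subseteq> ground N \<Longrightarrow> basis N B \<longleftrightarrow> basis M (g ` B \<union> K)"
  shows "strongly_base_orderable N"
  unfolding strongly_base_orderable_def
proof (intro conjI allI impI N)
  fix B\<^sub>1 B\<^sub>2 assume B: "basis N B\<^sub>1" "basis N B\<^sub>2"
  then have g: "B\<^sub>1 \<subseteq> ground N" "B\<^sub>2 \<subseteq> ground N" using indep_ground[OF N basis_indep] by simp_all
  then have "basis M (g ` B\<^sub>1 \<union> K)" "basis M (g ` B\<^sub>2 \<union> K)" using B b by simp_all
  then obtain \<sigma> where bij: "bij_betw \<sigma> (g ` B\<^sub>1 \<union> K) (g ` B\<^sub>2 \<union> K)"
    and ex: "\<And>X. X \<subseteq> g ` B\<^sub>1 \<union> K \<Longrightarrow> basis M ((g ` B\<^sub>1 \<union> K - X) \<union> \<sigma> ` X)"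
      "\<And>X. X \<subseteq> g ` B\<^sub>1 \<union> K \<Longrightarrow> basis M ((g ` B\<^sub>2 \<union> K - \<sigma> ` X) \<union> X)"
    using S unfolding strongly_base_orderable_def by metis
  have dK: "g ` X \<inter> K = {}" if "X \<subseteq> ground N" for X using K that by blast
  have \<sigma>K: "\<sigma> k = k" if k: "k \<in> K" for k
  proof -
    have "k \<in> \<sigma> ` (g ` B\<^sub>1 \<union> K)" using bij k by (simp add: bij_betw_def)
    then obtain x where x: "x \<in> g ` B\<^sub>1 \<union> K" "\<sigma> x = k" by auto
    have "x = k"
    proof (rule ccontr)
      assume "x \<noteq> k"
      then have "(g ` B\<^sub>1 \<union> K - {x}) \<union> \<sigma> ` {x} = g ` B\<^sub>1 \<union> K - {x}" using x k by auto
      then have "basis M (g ` B\<^sub>1 \<union> K - {x})" using ex(1)[of "{x}"] x(1) by simp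
      from basis_maximal[OF this basis_indep[OF \<open>basis M (g ` B\<^sub>1 \<union> K)\<close>]] x(1)
      show False by auto
    qed
    then show ?thesis using x by simp
  qed
  have injs: "inj_on \<sigma> (g ` B\<^sub>1 \<union> K)" using bij by (simp add: bij_betw_def)
  have "\<sigma> ` K = K" using \<sigma>K by simp
  then have "\<sigma> ` (g ` B\<^sub>1 \<union> K - K) = g ` B\<^sub>2 \<union> K - K"
    using inj_on_image_set_diff[OF injs, of "g ` B\<^sub>1 \<union> K" K] bij by (simp add: bij_betw_def)
  moreover have "g ` B\<^sub>1 \<union> K - K = g ` B\<^sub>1" "g ` B\<^sub>2 \<union> K - K = g ` B\<^sub>2"
    using dK[OF g(1)] dK[OF g(2)] by blast+
  ultimately have im: "\<sigma> ` g ` B\<^sub>1 = g ` B\<^sub>2" by simp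
  define \<tau> where "\<tau> x = inv_into (ground N) g (\<sigma> (g x))" for x
  have \<sigma>B: "\<sigma> (g x) \<in> g ` B\<^sub>2" if "x \<in> B\<^sub>1" for x using im that by blast
  have g\<tau>: "g (\<tau> x) = \<sigma> (g x)" if "x \<in> B\<^sub>1" for x
    unfolding \<tau>_def using \<sigma>B[OF that] g(2) by (intro f_inv_into_f) auto
  have "\<tau> ` B\<^sub>1 = inv_into (ground N) g ` g ` B\<^sub>2"
    unfolding im[symmetric] by (simp add: \<tau>_def image_image)
  then have im\<tau>: "\<tau> ` B\<^sub>1 = B\<^sub>2" using inv_into_image_cancel[OF inj g(2)] by simp
  have "inj_on \<tau> B\<^sub>1"
  proof (rule inj_onI)
    fix x y assume xy: "x \<in> B\<^sub>1" "y \<in> B\<^sub>1" "\<tau> x = \<tau> y"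
    then have "\<sigma> (g x) = \<sigma> (g y)" using g\<tau>[of x] g\<tau>[of y] by simp
    then have "g x = g y" by (rule inj_onD[OF injs]) (use xy in simp_all)
    then show "x = y" by (rule inj_onD[OF inj]) (use xy g(1) in blast)+
  qed
  then have bij\<tau>: "bij_betw \<tau> B\<^sub>1 B\<^sub>2" using im\<tau> by (simp add: bij_betw_def)
  have "basis N ((B\<^sub>1 - X) \<union> \<tau> ` X) \<and> basis N ((B\<^sub>2 - \<tau> ` X) \<union> X)" if X: "X \<subseteq> B\<^sub>1" for X
  proof -
    have "g ` \<tau> ` X = \<sigma> ` g ` X" using g\<tau> X unfolding image_image by (intro image_cong) auto
    moreover have \<tau>X: "\<tau> ` X \<subseteq> B\<^sub>2" using image_mono[OF X, of \<tau>] im\<tau> by simp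
    moreover have "g ` (B\<^sub>1 - X) = g ` B\<^sub>1 - g ` X" "g ` (B\<^sub>2 - \<tau> ` X) = g ` B\<^sub>2 - g ` \<tau> ` X"
      using g X \<tau>X by (intro inj_on_image_set_diff[OF inj]; auto)+
    moreover have "g ` X \<inter> K = {}" "g ` \<tau> ` X \<inter> K = {}"
      using dK[OF order_trans[OF X g(1)]] dK[OF order_trans[OF \<tau>X g(2)]] by simp_all
    moreover have "(S - R) \<union> R' \<union> K = (S \<union> K - R) \<union> R'" if "R \<inter> K = {}" for R R' S
      using that by blast
    ultimately have "g ` ((B\<^sub>1 - X) \<union> \<tau> ` X) \<union> K = (g ` B\<^sub>1 \<union> K - g ` X) \<union> \<sigma> ` g ` X"
      "g ` ((B\<^sub>2 - \<tau> ` X) \<union> X) \<union> K = (g ` B\<^sub>2 \<union> K - \<sigma> ` g ` X) \<union> g ` X"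
      by (simp_all only: image_Un)
    moreover have "g ` X \<subseteq> g ` B\<^sub>1 \<union> K" using X by blast
    moreover have "(B\<^sub>1 - X) \<union> \<tau> ` X \<subseteq> ground N" "(B\<^sub>2 - \<tau> ` X) \<union> X \<subseteq> ground N"
      using g X \<tau>X by auto
    ultimately show ?thesis using ex[of "g ` X"] b by simp
  qed
  then show "\<exists>\<tau>. bij_betw \<tau> B\<^sub>1 B\<^sub>2 \<and>
      (\<forall>X\<subseteq>B\<^sub>1. basis N ((B\<^sub>1 - X) \<union> \<tau> ` X) \<and> basis N ((B\<^sub>2 - \<tau> ` X) \<union> X))"
    using bij\<tau> by (intro exI[of _ \<tau>]) simp
qed

text \<open>A set \<open>K\<close> that completes one basis of the deletion to a basis of \<open>M\<close> completes all of them: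
  growing another one inside \<open>B \<union> C\<close> can only add elements of \<open>K\<close>, and by cardinality adds all.\<close>

lemma basis_delete_iff:
  assumes M: "matroid M"
  obtains K where "K \<subseteq> Y" "\<forall>B. B \<subseteq> ground M - Y \<longrightarrow> (basis (delete M Y) B \<longleftrightarrow> basis M (B \<union> K))"
proof -
  note D = matroid_delete[OF M, of Y]
  obtain B\<^sub>0 where B0: "basis (delete M Y) B\<^sub>0" using basis_extend[OF D empty_indep[OF D]] .
  then have i0: "B\<^sub>0 \<in> indeps M" "B\<^sub>0 \<subseteq> ground M - Y" using basis_indep[OF B0] by auto
  obtain C where C: "basis M C" "B\<^sub>0 \<subseteq> C" using basis_extend[OF M i0(1)] .
  note Ci = basis_indep[OF C(1)]
  have "C - Y \<in> indeps (delete M Y)" using indep_subset[OF M Ci] indep_ground[OF M Ci] by auto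
  then have CY: "C - Y = B\<^sub>0" using basis_maximal[OF B0, of "C - Y"] C(2) i0(2) by auto
  define K where "K = C \<inter> Y"
  have fK: "finite K" using indep_finite[OF M Ci] by (simp add: K_def)
  have CK: "C = B\<^sub>0 \<union> K" using CY by (auto simp: K_def)
  have cardK: "card (B \<union> K) = card B + card K" if "B \<subseteq> ground M - Y" for B
    using that fK finite_subset[OF that] matroid_finite[OF M] by (intro card_Un_disjoint) (auto simp: K_def)
  have "basis (delete M Y) B \<longleftrightarrow> basis M (B \<union> K)" if Bg: "B \<subseteq> ground M - Y" for B
  proof
    assume B: "basis (delete M Y) B"
    have iB: "B \<in> indeps M" using basis_indep[OF B] by simp
    obtain L where L: "L \<in> indeps M" "B \<subseteq> L" "L \<subseteq> B \<union> C" "card L = card C"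
      using augment_to_card[OF M iB Ci basis_card_max[OF M C(1) iB]] .
    have "L - Y \<in> indeps (delete M Y)" using indep_subset[OF M L(1)] indep_ground[OF M L(1)] by auto
    then have "L - Y = B" using basis_maximal[OF B, of "L - Y"] L(2) Bg by auto
    then have "L \<subseteq> B \<union> K" using L(3) by (auto simp: K_def)
    moreover have "card (B \<union> K) = card L"
      using cardK[OF Bg] cardK[OF i0(2)] basis_card_eq[OF D B B0] L(4) CK by simp
    moreover have "finite (B \<union> K)" using fK indep_finite[OF M iB] by simp
    ultimately have "L = B \<union> K" using card_subset_eq by metis
    then show "basis M (B \<union> K)" using basis_if_card[OF M C(1) L(1)] L(4) by simp
  next
    assume B: "basis M (B \<union> K)"
    have "B \<in> indeps (delete M Y)" using indep_subset[OF M basis_indep[OF B]] Bg by auto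
    moreover have "card B\<^sub>0 \<le> card B"
      using basis_card_eq[OF M B C(1)] cardK[OF Bg] cardK[OF i0(2)] CK by simp
    ultimately show "basis (delete M Y) B" using basis_if_card[OF D B0] by simp
  qed
  then show thesis by (intro that[of K]) (auto simp: K_def)
qed

lemma basis_contract_iff:
  assumes M: "matroid M" and X: "X \<subseteq> ground M" and K: "basis_of M X K" and B: "B \<subseteq> ground M - X"
  shows "basis (contract M X) B \<longleftrightarrow> basis M (B \<union> K)"
proof
  note iff = indeps_contract_iff[OF M X K]
  note KX = basis_ofD(2)[OF K]
  assume b: "basis (contract M X) B"
  have BK: "B \<union> K \<in> indeps M" using basis_indep[OF b] unfolding iff by simp
  obtain C where C: "basis M C" "B \<union> K \<subseteq> C" using basis_extend[OF M BK] .
  note Ci = basis_indep[OF C(1)]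
  have "C \<inter> X = K" using basis_ofD(3)[OF K indep_subset[OF M Ci]] C(2) KX by simp
  then have CK: "C = (C - X) \<union> K" by blast
  then have "C - X \<in> indeps (contract M X)" unfolding iff using Ci indep_ground[OF M Ci] by auto
  then have "C - X = B" using basis_maximal[OF b, of "C - X"] C(2) B by blast
  then show "basis M (B \<union> K)" using CK C(1) by simp
next
  note iff = indeps_contract_iff[OF M X K]
  note KX = basis_ofD(2)[OF K]
  assume b: "basis M (B \<union> K)"
  show "basis (contract M X) B"
    unfolding basis_def[of "contract M X"]
  proof (intro conjI ballI impI)
    show "B \<in> indeps (contract M X)" unfolding iff using B basis_indep[OF b] by simp
  next
    fix I assume I: "I \<in> indeps (contract M X)" "B \<subseteq> I"
    then have "I \<union> K = B \<union> K" using basis_maximal[OF b, of "I \<union> K"] unfolding iff by auto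
    then show "I = B" using I B KX unfolding iff by blast
  qed
qed

lemma strongly_base_orderable_minor:
  assumes S: "strongly_base_orderable M" and "minor N M"
  shows "strongly_base_orderable N"
proof -
  have M: "matroid M" using S by (simp add: strongly_base_orderable_def)
  obtain X Y where X: "X \<subseteq> ground M" and N: "N = delete (contract M X) Y"
    using assms(2) by (auto simp: minor_def)
  note MX = matroid_contract[OF M X]
  obtain K where K: "basis_of M X K" using obtain_basis_of[OF M] .
  have SX: "strongly_base_orderable (contract M X)"
    using basis_contract_iff[OF M X K] basis_ofD(2)[OF K]
    by (intro strongly_base_orderable_embed[OF S MX, where g = id and K = K]) auto
  obtain K' where "K' \<subseteq> Y" "\<forall>B. B \<subseteq> ground (contract M X) - Y \<longrightarrow>
      (basis (delete (contract M X) Y) B \<longleftrightarrow> basis (contract M X) (B \<union> K'))"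
    using basis_delete_iff[OF MX] .
  then show ?thesis
    unfolding N
    by (intro strongly_base_orderable_embed[OF SX matroid_delete[OF MX], where g = id and K = K']) auto
qed

lemma inj_on_image_subset_iff:
  assumes "inj_on f A" "X \<subseteq> A" "Y \<subseteq> A"
  shows "f ` X \<subseteq> f ` Y \<longleftrightarrow> X \<subseteq> Y"
proof
  assume XY: "f ` X \<subseteq> f ` Y"
  show "X \<subseteq> Y"
  proof
    fix x assume "x \<in> X"
    then show "x \<in> Y" using XY inj_on_image_mem_iff[OF assms(1) _ assms(3), of x] assms(2) by auto
  qed
qed (rule image_mono)

lemma basis_isomorphism:
  assumes bij: "bij_betw f (ground M) (ground N)"
    and iff: "\<And>X. X \<subseteq> ground M \<Longrightarrow> X \<in> indeps M \<longleftrightarrow> f ` X \<in> indeps N"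
    and MN: "indeps M \<subseteq> Pow (ground M)" "indeps N \<subseteq> Pow (ground N)" and B: "B \<subseteq> ground M"
  shows "basis M B \<longleftrightarrow> basis N (f ` B)"
proof
  have inj: "inj_on f (ground M)" and im: "f ` ground M = ground N"
    using bij by (simp_all add: bij_betw_def)
  {
    assume b: "basis M B"
    show "basis N (f ` B)"
      unfolding basis_def
    proof (intro conjI ballI impI)
      show "f ` B \<in> indeps N" using basis_indep[OF b] iff[OF B] by simp
    next
      fix J assume J: "J \<in> indeps N" "f ` B \<subseteq> J"
      then obtain I where I: "I \<subseteq> ground M" "J = f ` I" using MN(2) im by (metis PowD subsetD subset_image_iff)
      have "B \<subseteq> I" using inj_on_image_subset_iff[OF inj B I(1)] J I by simp
      then have "I = B" using basis_maximal[OF b] iff[OF I(1)] J I by simp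
      then show "J = f ` B" using I by simp
    qed
  next
    assume b: "basis N (f ` B)"
    show "basis M B"
      unfolding basis_def
    proof (intro conjI ballI impI)
      show "B \<in> indeps M" using basis_indep[OF b] iff[OF B] by simp
    next
      fix I assume I: "I \<in> indeps M" "B \<subseteq> I"
      then have Ig: "I \<subseteq> ground M" using MN(1) by blast
      have "f ` I = f ` B" using basis_maximal[OF b] iff[OF Ig] I by (simp add: image_mono)
      then show "I = B" using inj_on_image_eq_iff[OF inj Ig B] by simp
    qed
  }
qed

lemma strongly_base_orderable_if_gammoid:
  assumes "gammoid M"
  shows "strongly_base_orderable M"
proof -
  obtain N N' :: "nat pre_matroid" where M: "matroid M" and N: "transversal N" "minor N' N"
    and iso: "isomorphic M N'" using assms by (auto simp: gammoid_def)
  have S: "strongly_base_orderable N'"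
    using strongly_base_orderable_minor[OF strongly_base_orderable_if_transversal[OF N(1)] N(2)] .
  then have N': "matroid N'" by (simp add: strongly_base_orderable_def)
  obtain f where f: "bij_betw f (ground M) (ground N')"
    "\<And>X. X \<subseteq> ground M \<Longrightarrow> X \<in> indeps M \<longleftrightarrow> f ` X \<in> indeps N'"
    using iso by (auto simp: isomorphic_def)
  have "basis M B \<longleftrightarrow> basis N' (f ` B)" if "B \<subseteq> ground M" for B
    using indep_ground[OF M] indep_ground[OF N'] that by (intro basis_isomorphism[OF f]) auto
  then show ?thesis
    using f(1) by (intro strongly_base_orderable_embed[OF S M, of f "{}"]) (auto simp: bij_betw_def)
qed

section \<open>Minors and duals of transversal matroids are gammoids\<close>

definition relabel :: "('a \<Rightarrow> 'b) \<Rightarrow> 'a pre_matroid \<Rightarrow> 'b pre_matroid" where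
  "relabel f M = \<lparr>ground = f ` ground M, indeps = (`) f ` indeps M\<rparr>"

lemma relabel_simps [simp]:
  "ground (relabel f M) = f ` ground M"
  "indeps (relabel f M) = (`) f ` indeps M"
  by (simp_all add: relabel_def)

lemma relabel_iff:
  assumes "inj_on f (ground M)" "indeps M \<subseteq> Pow (ground M)" "X \<subseteq> ground M"
  shows "f ` X \<in> indeps (relabel f M) \<longleftrightarrow> X \<in> indeps M"
proof
  assume "f ` X \<in> indeps (relabel f M)"
  then obtain I where I: "I \<in> indeps M" "f ` X = f ` I" by auto
  then have "I \<subseteq> ground M" using assms(2) by blast
  then have "X = I" using inj_on_image_eq_iff[OF assms(1,3), of I] I(2) by blast
  then show "X \<in> indeps M" using I by simp
qed simp

lemma basis_relabel_iff:
  assumes "inj_on f (ground M)" "indeps M \<subseteq> Pow (ground M)" "X \<subseteq> ground M"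
  shows "basis (relabel f M) (f ` X) \<longleftrightarrow> basis M X"
  using assms relabel_iff[OF assms(1,2)]
  by (intro basis_isomorphism[symmetric]) (auto simp: bij_betw_def)

lemma indeps_dual_subset: "indeps (dual M) \<subseteq> Pow (ground (dual M))"
  by (auto simp: dual_simps)

lemma relabel_dual:
  assumes inj: "inj_on f (ground M)" and M: "indeps M \<subseteq> Pow (ground M)"
  shows "relabel f (dual M) = dual (relabel f M)"
proof -
  have diff: "f ` (ground M - B) = f ` ground M - f ` B" if "B \<subseteq> ground M" for B
    using inj_on_image_set_diff[OF inj _ that, of "ground M"] by simp
  have bg: "B \<subseteq> ground M" if "basis M B" for B using basis_indep[OF that] M by blast
  have "J \<in> indeps (relabel f (dual M)) \<longleftrightarrow> J \<in> indeps (dual (relabel f M))" for J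
  proof
    assume "J \<in> indeps (relabel f (dual M))"
    then obtain I B where I: "J = f ` I" "basis M B" "I \<subseteq> ground M - B" by (auto simp: dual_simps)
    then have "J \<subseteq> f ` ground M - f ` B" using diff[OF bg] by blast
    moreover have "basis (relabel f M) (f ` B)"
      using basis_relabel_iff[OF inj M bg] I(2) by simp
    ultimately show "J \<in> indeps (dual (relabel f M))" by (auto simp: dual_simps)
  next
    assume "J \<in> indeps (dual (relabel f M))"
    then obtain B' where B': "basis (relabel f M) B'" "J \<subseteq> f ` ground M - B'"
      by (auto simp: dual_simps)
    obtain B where B: "B \<in> indeps M" "B' = f ` B" using basis_indep[OF B'(1)] by auto
    have Bg: "B \<subseteq> ground M" using B M by blast
    have "basis M B" using basis_relabel_iff[OF inj M Bg] B'(1) B(2) by simp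
    moreover obtain I where "I \<subseteq> ground M - B" "J = f ` I"
      using B'(2) B(2) diff[OF Bg] by (metis subset_image_iff)
    ultimately show "J \<in> indeps (relabel f (dual M))" by (auto simp: dual_simps)
  qed
  then have "indeps (relabel f (dual M)) = indeps (dual (relabel f M))" by blast
  moreover have "ground (relabel f (dual M)) = ground (dual (relabel f M))" by (simp add: dual_simps)
  ultimately show ?thesis by (intro pre_matroid.equality) simp_all
qed

lemma relabel_delete:
  assumes inj: "inj_on f (ground M)" and M: "indeps M \<subseteq> Pow (ground M)" and Y: "Y \<subseteq> ground M"
  shows "relabel f (delete M Y) = delete (relabel f M) (f ` Y)"
proof -
  have diff: "f ` (ground M - Y) = f ` ground M - f ` Y"
    using inj_on_image_set_diff[OF inj _ Y, of "ground M"] by simp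
  have "f ` I \<subseteq> f ` (ground M - Y) \<longleftrightarrow> I \<subseteq> ground M - Y" if "I \<in> indeps M" for I
    using that M inj by (intro inj_on_image_subset_iff) auto
  then have "(`) f ` {I \<in> indeps M. I \<subseteq> ground M - Y} =
      {J \<in> (`) f ` indeps M. J \<subseteq> f ` (ground M - Y)}"
    by auto
  then show ?thesis using diff by (intro pre_matroid.equality) simp_all
qed

lemma relabel_contract:
  assumes inj: "inj_on f (ground M)" and M: "indeps M \<subseteq> Pow (ground M)" and X: "X \<subseteq> ground M"
  shows "relabel f (contract M X) = contract (relabel f M) (f ` X)"
proof -
  have "relabel f (contract M X) = dual (relabel f (delete (dual M) X))"
    unfolding contract_def using inj
    by (intro relabel_dual) (auto simp: dual_simps intro: inj_on_subset)
  also have "relabel f (delete (dual M) X) = delete (relabel f (dual M)) (f ` X)"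
    using inj X indeps_dual_subset by (intro relabel_delete) (auto simp: dual_simps)
  finally show ?thesis by (simp add: contract_def relabel_dual[OF inj M])
qed

lemma transversal_relabel:
  assumes T: "transversal M" and inj: "inj_on f (ground M)"
  shows "transversal (relabel f M)"
proof -
  obtain n \<A> where fin: "finite (ground M)" and \<A>: "\<forall>i<n. \<A> i \<subseteq> ground M"
    and eq: "indeps M = {X. X \<subseteq> ground M \<and> partial_transversal n \<A> X}"
    using T by (auto simp: transversal_def)
  have pt: "partial_transversal n (\<lambda>i. f ` \<A> i) (f ` X) \<longleftrightarrow> partial_transversal n \<A> X"
    if X: "X \<subseteq> ground M" for X
  proof
    assume "partial_transversal n (\<lambda>i. f ` \<A> i) (f ` X)"
    then obtain \<phi> where \<phi>: "matching n (\<lambda>i. f ` \<A> i) \<phi> (f ` X)" by (auto simp: partial_transversal_iff)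
    have "x \<in> \<A> (\<phi> (f x))" if "x \<in> X" for x
    proof -
      have "\<phi> (f x) < n" "f x \<in> f ` \<A> (\<phi> (f x))" using \<phi> that by (auto simp: matching_def)
      moreover have "x \<in> ground M" using that X by blast
      ultimately show ?thesis using inj_on_image_mem_iff[OF inj, of x "\<A> (\<phi> (f x))"] \<A> by simp
    qed
    moreover have "inj_on (\<phi> \<circ> f) X"
      using \<phi> inj_on_subset[OF inj X] by (intro comp_inj_on) (auto simp: matching_def)
    ultimately have "matching n \<A> (\<phi> \<circ> f) X" using \<phi> by (auto simp: matching_def)
    then show "partial_transversal n \<A> X" by (auto simp: partial_transversal_iff)
  next
    assume "partial_transversal n \<A> X"
    then obtain \<phi> where \<phi>: "matching n \<A> \<phi> X" by (auto simp: partial_transversal_iff)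
    note inv = inv_into_f_f[OF inj_on_subset[OF inj X]]
    have "matching n (\<lambda>i. f ` \<A> i) (\<phi> \<circ> inv_into X f) (f ` X)"
      using \<phi> by (auto simp: matching_def inv inj_on_def)
    then show "partial_transversal n (\<lambda>i. f ` \<A> i) (f ` X)" by (auto simp: partial_transversal_iff)
  qed
  have "indeps (relabel f M) =
      {Y. Y \<subseteq> ground (relabel f M) \<and> partial_transversal n (\<lambda>i. f ` \<A> i) Y}"
  proof (intro set_eqI iffI)
    fix Y assume "Y \<in> indeps (relabel f M)"
    then obtain X where "Y = f ` X" "X \<subseteq> ground M" "partial_transversal n \<A> X" by (auto simp: eq)
    then show "Y \<in> {Y. Y \<subseteq> ground (relabel f M) \<and> partial_transversal n (\<lambda>i. f ` \<A> i) Y}"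
      using pt by auto
  next
    fix Y assume Y: "Y \<in> {Y. Y \<subseteq> ground (relabel f M) \<and> partial_transversal n (\<lambda>i. f ` \<A> i) Y}"
    then obtain X where "Y = f ` X" "X \<subseteq> ground M" by (auto simp: subset_image_iff)
    then show "Y \<in> indeps (relabel f M)" using pt Y by (auto simp: eq)
  qed
  then show ?thesis
    unfolding transversal_def using fin image_mono[OF \<A>[rule_format], of _ f]
    by (intro conjI exI[of _ n] exI[of _ "\<lambda>i. f ` \<A> i"]) auto
qed

text \<open>Gammoids are defined by transversal matroids over the natural numbers. A transversal matroid
  over any type can be used instead, since its elements can be numbered.\<close>

lemma gammoid_if_isomorphic_minor:
  assumes M: "matroid M" and T: "transversal T"
    and XY: "X \<subseteq> ground T" "Y \<subseteq> ground T" "X \<inter> Y = {}"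
    and iso: "isomorphic M (delete (contract T X) Y)"
  shows "gammoid M"
proof -
  note MT = matroid_if_transversal[OF T]
  let ?N = "delete (contract T X) Y"
  obtain f :: "_ \<Rightarrow> nat" where inj: "inj_on f (ground T)"
    using finite_imp_inj_to_nat_seg[OF matroid_finite[OF MT]] by auto
  note sub = inj_on_subset[OF inj]
  have MX: "matroid (contract T X)" using matroid_contract[OF MT XY(1)] .
  have "relabel f ?N = delete (relabel f (contract T X)) (f ` Y)"
    using indep_ground[OF MX] XY sub by (intro relabel_delete) auto
  also have "relabel f (contract T X) = contract (relabel f T) (f ` X)"
    using indep_ground[OF MT] XY inj by (intro relabel_contract) auto
  finally have "minor (relabel f ?N) (relabel f T)"
    unfolding minor_def using XY inj_on_image_Int[OF inj XY(1,2)]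
    by (intro exI[of _ "f ` X"] exI[of _ "f ` Y"]) auto
  moreover have "isomorphic M (relabel f ?N)"
  proof -
    obtain h where h: "bij_betw h (ground M) (ground ?N)"
      "\<forall>Z\<subseteq>ground M. Z \<in> indeps M \<longleftrightarrow> h ` Z \<in> indeps ?N"
      using iso unfolding isomorphic_def by auto
    have injN: "inj_on f (ground ?N)" by (rule sub) auto
    have "bij_betw f (ground ?N) (ground (relabel f ?N))" using injN by (simp add: bij_betw_def)
    from bij_betw_trans[OF h(1) this] have "bij_betw (f \<circ> h) (ground M) (ground (relabel f ?N))" .
    moreover have "Z \<in> indeps M \<longleftrightarrow> (f \<circ> h) ` Z \<in> indeps (relabel f ?N)" if Z: "Z \<subseteq> ground M" for Z
    proof -
      have "h ` Z \<subseteq> ground ?N" using h(1) Z by (auto simp: bij_betw_def)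
      then have "f ` h ` Z \<in> indeps (relabel f ?N) \<longleftrightarrow> h ` Z \<in> indeps ?N"
        by (intro relabel_iff[OF injN]) auto
      then show ?thesis using h(2) Z by (simp only: image_comp)
    qed
    ultimately show ?thesis unfolding isomorphic_def by blast
  qed
  ultimately show ?thesis
    unfolding gammoid_def using M transversal_relabel[OF T inj] by blast
qed

lemma gammoid_if_minor_transversal:
  assumes T: "transversal T" and "minor M T"
  shows "gammoid M"
proof -
  obtain X Y where XY: "X \<subseteq> ground T" "Y \<subseteq> ground T" "X \<inter> Y = {}"
    and M: "M = delete (contract T X) Y" using assms(2) by (auto simp: minor_def)
  have "matroid M" unfolding M
    using matroid_delete[OF matroid_contract[OF matroid_if_transversal[OF T] XY(1)]] .
  moreover have "isomorphic M (delete (contract T X) Y)"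
    unfolding isomorphic_def M by (intro exI[of _ id]) auto
  ultimately show ?thesis by (rule gammoid_if_isomorphic_minor[OF _ T XY])
qed

lemma gammoid_delete:
  assumes G: "gammoid M" and Y: "Y \<subseteq> ground M"
  shows "gammoid (delete M Y)"
proof -
  obtain N N' :: "nat pre_matroid" where M: "matroid M" and N: "transversal N" "minor N' N"
    and iso: "isomorphic M N'" using G by (auto simp: gammoid_def)
  obtain X Z where XZ: "X \<subseteq> ground N" "Z \<subseteq> ground N" "X \<inter> Z = {}"
    and N': "N' = delete (contract N X) Z" using N(2) by (auto simp: minor_def)
  obtain f where f: "bij_betw f (ground M) (ground N')"
    "\<forall>X\<subseteq>ground M. X \<in> indeps M \<longleftrightarrow> f ` X \<in> indeps N'"
    using iso by (auto simp: isomorphic_def)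
  have inj: "inj_on f (ground M)" and im: "f ` ground M = ground N'"
    using f(1) by (simp_all add: bij_betw_def)
  have fY: "f ` Y \<subseteq> ground N'" using Y im by auto
  have diff: "f ` (ground M - Y) = ground N' - f ` Y"
    using inj_on_image_set_diff[OF inj _ Y, of "ground M"] im by simp
  have "isomorphic (delete M Y) (delete N' (f ` Y))"
    unfolding isomorphic_def
  proof (intro exI[of _ f] conjI allI impI)
    show "bij_betw f (ground (delete M Y)) (ground (delete N' (f ` Y)))"
      using diff inj_on_subset[OF inj] by (auto simp: bij_betw_def)
  next
    fix W assume W: "W \<subseteq> ground (delete M Y)"
    then have "f ` W \<subseteq> f ` (ground M - Y)" by auto
    then show "W \<in> indeps (delete M Y) \<longleftrightarrow> f ` W \<in> indeps (delete N' (f ` Y))"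
      using W f(2) diff by auto
  qed
  then have "isomorphic (delete M Y) (delete (contract N X) (Z \<union> f ` Y))"
    unfolding N' delete_delete .
  moreover have "Z \<union> f ` Y \<subseteq> ground N" "X \<inter> (Z \<union> f ` Y) = {}" using XZ fY N' by auto
  ultimately show ?thesis
    by (intro gammoid_if_isomorphic_minor[OF matroid_delete[OF M] N(1) XZ(1)])
qed

text \<open>Let the dual of \<open>N\<close> be presented by \<open>\<A>\<close>. Add the \<open>n\<close> indices as new elements and present the
  enlarged ground set by one set for each old element \<open>e\<close>, consisting of \<open>e\<close> and the indices \<open>i\<close>
  with \<open>e \<in> \<A> i\<close>. A set \<open>B\<close> of old elements together with a set \<open>J\<close> of indices is then a partial
  transversal precisely when \<open>J\<close> can be matched into the complement of \<open>B\<close>. If \<open>J\<close> is as large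
  as possible, this says that the complement of \<open>B\<close> contains a basis of the dual, so
  contracting all indices gives back \<open>N\<close>.\<close>

lemma gammoid_if_dual_transversal:
  fixes N :: "'a pre_matroid"
  assumes N: "matroid N" and T: "transversal (dual N)"
  shows "gammoid N"
proof -
  let ?E = "ground N"
  note MT = matroid_if_transversal[OF T]
  have finE: "finite ?E" by (rule matroid_finite[OF N])
  obtain n \<A> where \<A>: "indeps (dual N) = {X. X \<subseteq> ?E \<and> partial_transversal n \<A> X}"
    using T by (auto simp: transversal_def dual_simps)
  obtain idx where idx: "bij_betw idx ?E {0..<card ?E}"
    using ex_bij_betw_finite_nat[OF finE] by auto
  define elt where "elt = inv_into ?E idx"
  have elt: "\<And>e. e \<in> ?E \<Longrightarrow> elt (idx e) = e" "\<And>j. j < card ?E \<Longrightarrow> idx (elt j) = j"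
    "\<And>j. j < card ?E \<Longrightarrow> elt j \<in> ?E" "\<And>e. e \<in> ?E \<Longrightarrow> idx e < card ?E"
    unfolding elt_def using idx
    by (auto simp: bij_betw_inv_into_left bij_betw_inv_into_right bij_betw_def intro: inv_into_into)
  define \<B> :: "nat \<Rightarrow> ('a + nat) set"
    where "\<B> j = insert (Inl (elt j)) (Inr ` {i. i < n \<and> elt j \<in> \<A> i})" for j
  define P :: "('a + nat) pre_matroid" where "P =
    \<lparr>ground = Inl ` ?E \<union> Inr ` {..<n},
     indeps = {S. S \<subseteq> Inl ` ?E \<union> Inr ` {..<n} \<and> partial_transversal (card ?E) \<B> S}\<rparr>"
  have P: "transversal P"
    unfolding transversal_def P_def using finE elt(3)
    by (auto intro!: exI[of _ "card ?E"] exI[of _ \<B>] simp: \<B>_def)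
  note MP = matroid_if_transversal[OF P]
  have \<B>: "Inl b \<in> \<B> j \<longleftrightarrow> b = elt j" "Inr i \<in> \<B> j \<longleftrightarrow> i < n \<and> elt j \<in> \<A> i" for b i j
    by (auto simp: \<B>_def)
  have indep_P: "Inl ` B \<union> Inr ` J \<in> indeps P \<longleftrightarrow>
      (\<exists>\<chi>. inj_on \<chi> J \<and> \<chi> ` J \<subseteq> ?E - B \<and> (\<forall>i\<in>J. \<chi> i \<in> \<A> i))"
    if B: "B \<subseteq> ?E" and J: "J \<subseteq> {..<n}" for B J
  proof
    assume "Inl ` B \<union> Inr ` J \<in> indeps P"
    then obtain \<phi> where \<phi>: "matching (card ?E) \<B> \<phi> (Inl ` B \<union> Inr ` J)"
      by (auto simp: P_def partial_transversal_iff)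
    have inj: "inj_on \<phi> (Inl ` B \<union> Inr ` J)" using \<phi> by (simp add: matching_def)
    have at: "\<phi> x < card ?E" "x \<in> \<B> (\<phi> x)" if "x \<in> Inl ` B \<union> Inr ` J" for x
      using \<phi> that by (simp_all add: matching_def)
    have \<phi>B: "\<phi> (Inl b) = idx b" if "b \<in> B" for b
    proof -
      have "\<phi> (Inl b) < card ?E" "b = elt (\<phi> (Inl b))"
        using at[of "Inl b"] that by (simp_all add: \<B>)
      then show ?thesis using elt(2)[of "\<phi> (Inl b)"] by simp
    qed
    have \<phi>J: "\<phi> (Inr i) < card ?E" "elt (\<phi> (Inr i)) \<in> \<A> i" if "i \<in> J" for i
      using at[of "Inr i"] that by (simp_all add: \<B>)
    have "inj_on (\<lambda>i. elt (\<phi> (Inr i))) J"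
    proof (rule inj_onI)
      fix i j assume ij: "i \<in> J" "j \<in> J" "elt (\<phi> (Inr i)) = elt (\<phi> (Inr j))"
      from arg_cong[OF ij(3), of idx] have "\<phi> (Inr i) = \<phi> (Inr j)"
        by (simp only: elt(2)[OF \<phi>J(1)[OF ij(1)]] elt(2)[OF \<phi>J(1)[OF ij(2)]])
      then have "(Inr i :: 'a + nat) = Inr j" by (rule inj_onD[OF inj]) (use ij in auto)
      then show "i = j" by simp
    qed
    moreover have "elt (\<phi> (Inr i)) \<in> ?E - B" if i: "i \<in> J" for i
    proof
      show "elt (\<phi> (Inr i)) \<in> ?E" by (rule elt(3)[OF \<phi>J(1)[OF i]])
      show "elt (\<phi> (Inr i)) \<notin> B"
      proof
        assume b: "elt (\<phi> (Inr i)) \<in> B"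
        then have "\<phi> (Inl (elt (\<phi> (Inr i)))) = \<phi> (Inr i)" using \<phi>B elt(2) \<phi>J(1)[OF i] by simp
        from inj_onD[OF inj this] b i show False by auto
      qed
    qed
    ultimately show "\<exists>\<chi>. inj_on \<chi> J \<and> \<chi> ` J \<subseteq> ?E - B \<and> (\<forall>i\<in>J. \<chi> i \<in> \<A> i)"
      using \<phi>J(2) by (intro exI[of _ "\<lambda>i. elt (\<phi> (Inr i))"]) blast
  next
    assume "\<exists>\<chi>. inj_on \<chi> J \<and> \<chi> ` J \<subseteq> ?E - B \<and> (\<forall>i\<in>J. \<chi> i \<in> \<A> i)"
    then obtain \<chi> where \<chi>: "inj_on \<chi> J" "\<chi> ` J \<subseteq> ?E - B" "\<forall>i\<in>J. \<chi> i \<in> \<A> i" by auto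
    define \<phi> where "\<phi> = case_sum idx (idx \<circ> \<chi>)"
    have inj: "x = y" if "x \<in> ?E" "y \<in> ?E" "idx x = idx y" for x y
      using that elt(1) by metis
    have \<chi>E: "\<chi> i \<in> ?E" "\<chi> i \<notin> B" if "i \<in> J" for i using \<chi>(2) that by auto
    have iB: "b = c" if "b \<in> B" "c \<in> B" "idx b = idx c" for b c
      using inj[OF subsetD[OF B] subsetD[OF B]] that by simp
    have iJ: "i = j" if "i \<in> J" "j \<in> J" "idx (\<chi> i) = idx (\<chi> j)" for i j
      using inj_onD[OF \<chi>(1) inj[OF \<chi>E(1) \<chi>E(1)]] that by simp
    have iBJ: "idx b \<noteq> idx (\<chi> i)" if "b \<in> B" "i \<in> J" for b i
      using inj[OF subsetD[OF B] \<chi>E(1), of b i] \<chi>E(2)[of i] that by auto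
    have "inj_on \<phi> (Inl ` B \<union> Inr ` J)"
    proof (rule inj_onI)
      fix x y assume xy: "x \<in> Inl ` B \<union> Inr ` J" "y \<in> Inl ` B \<union> Inr ` J" "\<phi> x = \<phi> y"
      show "x = y"
        using xy iBJ iBJ[symmetric] by (auto simp: \<phi>_def dest: iB iJ)
    qed
    moreover have "\<phi> x < card ?E \<and> x \<in> \<B> (\<phi> x)" if "x \<in> Inl ` B \<union> Inr ` J" for x
      using that B J \<chi>(3) \<chi>E elt(1,4) by (auto simp: \<phi>_def \<B>)
    ultimately have "matching (card ?E) \<B> \<phi> (Inl ` B \<union> Inr ` J)" by (simp add: matching_def)
    then show "Inl ` B \<union> Inr ` J \<in> indeps P"
      using B J by (auto simp: P_def partial_transversal_iff)
  qed
  have from_\<chi>: "\<chi> ` J \<in> indeps (dual N)"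
    if \<chi>: "inj_on \<chi> J" "\<chi> ` J \<subseteq> ?E" "\<forall>i\<in>J. \<chi> i \<in> \<A> i" and J: "J \<subseteq> {..<n}" for \<chi> J
  proof -
    have "matching n \<A> (inv_into J \<chi>) (\<chi> ` J)"
      using \<chi> J by (auto simp: matching_def inj_on_inv_into)
    then show ?thesis using \<chi>(2) by (auto simp: \<A> partial_transversal_iff)
  qed
  have to_\<chi>: "\<exists>J \<chi>. J \<subseteq> {..<n} \<and> inj_on \<chi> J \<and> \<chi> ` J = X \<and> (\<forall>i\<in>J. \<chi> i \<in> \<A> i)"
    if X: "X \<in> indeps (dual N)" for X
  proof -
    obtain \<phi> where \<phi>: "matching n \<A> \<phi> X" using X by (auto simp: \<A> partial_transversal_iff)
    then have inj: "inj_on \<phi> X" by (simp add: matching_def)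
    show ?thesis
      using \<phi> inj inv_into_image_cancel[OF inj order_refl]
      by (intro exI[of _ "\<phi> ` X"] exI[of _ "inv_into X \<phi>"]) (auto simp: matching_def inj_on_inv_into)
  qed
  define X\<^sub>0 :: "('a + nat) set" where "X\<^sub>0 = Inr ` {..<n}"
  have X0: "X\<^sub>0 \<subseteq> ground P" by (auto simp: X\<^sub>0_def P_def)
  obtain K where K: "basis_of P X\<^sub>0 K" using obtain_basis_of[OF MP] .
  then obtain J\<^sub>0 where J0: "J\<^sub>0 \<subseteq> {..<n}" "K = Inr ` J\<^sub>0"
    using basis_ofD(2)[OF K] unfolding X\<^sub>0_def by (metis subset_imageE)
  have card_J0: "card J\<^sub>0 = card K" unfolding J0(2) by (simp add: card_image)
  have indep_Inr: "Inr ` J \<in> indeps P \<longleftrightarrow> (\<exists>\<chi>. inj_on \<chi> J \<and> \<chi> ` J \<subseteq> ?E \<and> (\<forall>i\<in>J. \<chi> i \<in> \<A> i))"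
    if "J \<subseteq> {..<n}" for J
    using indep_P[of "{}" J] that by simp
  obtain \<chi>\<^sub>0 where \<chi>0: "inj_on \<chi>\<^sub>0 J\<^sub>0" "\<chi>\<^sub>0 ` J\<^sub>0 \<subseteq> ?E" "\<forall>i\<in>J\<^sub>0. \<chi>\<^sub>0 i \<in> \<A> i"
    using indep_Inr[OF J0(1)] basis_ofD(1)[OF K] J0(2) by auto
  \<comment> \<open>\<open>J\<^sub>0\<close> is as large as a basis of the dual.\<close>
  have le_J0: "card X \<le> card J\<^sub>0" if X: "X \<in> indeps (dual N)" for X
  proof -
    obtain J \<chi> where J: "J \<subseteq> {..<n}" "inj_on \<chi> J" "\<chi> ` J = X" "\<forall>i\<in>J. \<chi> i \<in> \<A> i"
      using to_\<chi>[OF X] by auto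
    have "Inr ` J \<in> indeps P" using indep_Inr[OF J(1)] J X by (auto simp: \<A>)
    then have "card (Inr ` J :: ('a + nat) set) \<le> card K"
      using J(1) by (intro basis_of_card_max[OF MP K]) (auto simp: X\<^sub>0_def)
    then show ?thesis using card_image[OF J(2)] J(3) card_J0 by (simp add: card_image)
  qed
  have main: "I \<in> indeps N \<longleftrightarrow> Inl ` I \<in> indeps (contract P X\<^sub>0)" if I: "I \<subseteq> ?E" for I
  proof -
    have "I \<in> indeps N \<longleftrightarrow> Inl ` I \<union> Inr ` J\<^sub>0 \<in> indeps P"
    proof
      assume iI: "I \<in> indeps N"
      obtain B where B: "basis N B" "I \<subseteq> B" using basis_extend[OF N iI] .
      have Bg: "B \<subseteq> ?E" by (rule indep_ground[OF N basis_indep[OF B(1)]])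
      then have X: "basis (dual N) (?E - B)"
        using B(1) unfolding basis_dual_iff[OF N] by (simp add: double_diff)
      obtain J \<chi> where J: "J \<subseteq> {..<n}" "inj_on \<chi> J" "\<chi> ` J = ?E - B" "\<forall>i\<in>J. \<chi> i \<in> \<A> i"
        using to_\<chi>[OF basis_indep[OF X]] by auto
      have "Inr ` J \<in> indeps P" using indep_Inr[OF J(1)] J by auto
      moreover have "card K \<le> card (Inr ` J :: ('a + nat) set)"
        using basis_card_max[OF MT X from_\<chi>[OF \<chi>0 J0(1)]] card_image[OF \<chi>0(1)] card_image[OF J(2)]
          J(3) card_J0 by (simp add: card_image)
      ultimately have bJ: "basis_of P X\<^sub>0 (Inr ` J)"
        using J(1) by (intro basis_of_if_card[OF MP K]) (auto simp: X\<^sub>0_def)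
      have "\<chi> ` J \<subseteq> ?E - I" unfolding J(3) using B(2) by auto
      then have "Inl ` I \<union> Inr ` J \<in> indeps P" using indep_P[OF I J(1)] J(2,4) by blast
      moreover have "Inl ` I \<inter> X\<^sub>0 = {}" by (auto simp: X\<^sub>0_def)
      ultimately show "Inl ` I \<union> Inr ` J\<^sub>0 \<in> indeps P"
        using basis_of_swap[OF MP bJ K] J0(2) by simp
    next
      assume "Inl ` I \<union> Inr ` J\<^sub>0 \<in> indeps P"
      then obtain \<chi> where \<chi>: "inj_on \<chi> J\<^sub>0" "\<chi> ` J\<^sub>0 \<subseteq> ?E - I" "\<forall>i\<in>J\<^sub>0. \<chi> i \<in> \<A> i"
        using indep_P[OF I J0(1)] by auto
      have sub: "\<chi> ` J\<^sub>0 \<subseteq> ?E" using \<chi>(2) by auto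
      have X: "\<chi> ` J\<^sub>0 \<in> indeps (dual N)" by (rule from_\<chi>[OF \<chi>(1) sub \<chi>(3) J0(1)])
      obtain X' where X': "basis (dual N) X'" using basis_extend[OF MT X] .
      have "basis (dual N) (\<chi> ` J\<^sub>0)"
        using le_J0[OF basis_indep[OF X']] card_image[OF \<chi>(1)] by (intro basis_if_card[OF MT X' X]) simp
      then have "basis N (?E - \<chi> ` J\<^sub>0)" unfolding basis_dual_iff[OF N] by simp
      then show "I \<in> indeps N" using indep_subset[OF N basis_indep, of "?E - \<chi> ` J\<^sub>0" I] \<chi>(2) I by auto
    qed
    moreover have "Inl ` I \<subseteq> ground P - X\<^sub>0" using I by (auto simp: P_def X\<^sub>0_def)
    ultimately show ?thesis using indeps_contract_iff[OF MP X0 K] J0(2) by simp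
  qed
  have "isomorphic N (delete (contract P X\<^sub>0) {})"
    unfolding isomorphic_def
  proof (intro exI[of _ Inl] conjI allI impI)
    have "ground (delete (contract P X\<^sub>0) {}) = Inl ` ?E" by (auto simp: P_def X\<^sub>0_def)
    then show "bij_betw Inl ?E (ground (delete (contract P X\<^sub>0) {}))" by (simp add: bij_betw_def)
  next
    fix I assume I: "I \<subseteq> ?E"
    then have "Inl ` I \<subseteq> ground P - X\<^sub>0" by (auto simp: P_def X\<^sub>0_def)
    then show "I \<in> indeps N \<longleftrightarrow> Inl ` I \<in> indeps (delete (contract P X\<^sub>0) {})"
      using main[OF I] by simp
  qed
  then show ?thesis
    by (intro gammoid_if_isomorphic_minor[OF N P X0]) auto
qed

text \<open>A minor that contracts some \<open>x\<close> is a minor of the transversal matroid obtained by contracting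
  \<open>x\<close>. A minor that only deletes is a deletion from a gammoid.\<close>

lemma gammoid_if_proper_minor:
  assumes M: "matroid M"
    and con: "\<forall>x\<in>ground M. transversal (contract M {x})"
    and del: "\<forall>x\<in>ground M. transversal (dual (delete M {x}))"
    and N: "proper_minor N M"
  shows "gammoid N"
proof -
  obtain X Y where XY: "X \<subseteq> ground M" "Y \<subseteq> ground M" "X \<inter> Y = {}" "X \<union> Y \<noteq> {}"
    and Neq: "N = delete (contract M X) Y" using N by (auto simp: proper_minor_def)
  show ?thesis
  proof (cases "X = {}")
    case True
    then obtain y where y: "y \<in> Y" using XY by auto
    have "gammoid (delete M {y})"
      using y XY(2) del by (intro gammoid_if_dual_transversal matroid_delete[OF M]) auto
    then have "gammoid (delete (delete M {y}) (Y - {y}))" by (rule gammoid_delete) (use XY(2) in auto)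
    then show ?thesis
      using y unfolding Neq True contract_empty[OF M] delete_delete by (simp add: insert_absorb)
  next
    case False
    then obtain x where x: "x \<in> X" by auto
    have "minor N (contract M {x})"
      unfolding minor_def Neq contract_insert[OF M XY(1) x] using XY x
      by (intro exI[of _ "X - {x}"] exI[of _ Y]) auto
    then show ?thesis using con x XY(1) by (intro gammoid_if_minor_transversal) auto
  qed
qed

section \<open>Independence and coindependence from cyclic flats\<close>

lemma dependent_contains_circuit:
  assumes M: "matroid M" and X: "X \<subseteq> ground M" "X \<notin> indeps M"
  obtains C where "circuit M C" "C \<subseteq> X"
proof -
  let ?S = "{D \<in> Pow X. D \<notin> indeps M}"
  have "finite X" using X(1) matroid_finite[OF M] by (rule finite_subset)
  then have "finite ?S" "?S \<noteq> {}" using X(2) by auto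
  from finite_has_minimal[OF this] obtain C
    where C: "C \<in> ?S" "\<forall>D\<in>?S. D \<subseteq> C \<longrightarrow> C = D" by (elim bexE) (rule that)
  have "D \<in> indeps M" if "D \<subset> C" for D using C that by (auto dest: bspec[of _ _ D])
  then have "circuit M C" using C(1) X(1) by (auto simp: circuit_def)
  then show thesis using C(1) that by simp
qed

text \<open>The union \<open>U\<close> of the circuits inside \<open>W\<close> carries all dependence of \<open>W\<close>: the elements of \<open>W - U\<close>
  are coloops of \<open>W\<close>. The closure of \<open>U\<close> has the same rank as \<open>U\<close> and is a cyclic flat, since
  each element of the closure completes a circuit with elements of a basis of \<open>U\<close>.\<close>

lemma cyclic_flat_rank_bound:
  assumes M: "matroid M" and W: "W \<subseteq> ground M"
  obtains Z where "cyclic_flat M Z" "rank M Z + card (W - Z) \<le> rank M W"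
proof -
  define U where "U = \<Union>{C. circuit M C \<and> C \<subseteq> W}"
  have UW: "U \<subseteq> W" by (auto simp: U_def)
  have in_U: "C \<subseteq> U" if "circuit M C" "C \<subseteq> W" for C using that by (auto simp: U_def)
  obtain J where J: "basis_of M U J" using obtain_basis_of[OF M] .
  note Ji = basis_ofD(1)[OF J] and JU = basis_ofD(2)[OF J]
  define Z where "Z = U \<union> {y \<in> ground M. insert y J \<notin> indeps M}"
  have JZ: "J \<subseteq> Z" using JU by (auto simp: Z_def)
  have "basis_of M Z J"
    unfolding basis_of_def
  proof (intro conjI ballI impI Ji JZ)
    fix I assume I: "I \<in> indeps M" "J \<subseteq> I" "I \<subseteq> Z"
    show "I = J"
    proof (rule ccontr)
      assume "I \<noteq> J"
      then obtain y where y: "y \<in> I" "y \<notin> J" using I(2) by auto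
      have iy: "insert y J \<in> indeps M" using y I(2) by (intro indep_subset[OF M I(1)]) auto
      then have "y \<in> U" using y I(3) by (auto simp: Z_def)
      then have "insert y J = J" using JU iy by (intro basis_ofD(3)[OF J]) auto
      then show False using y by auto
    qed
  qed
  then have rZ: "rank M Z = card J" by (rule rank_eq_card[OF M])
  have "flat M Z"
    unfolding flat_def
  proof (intro conjI ballI)
    show "Z \<subseteq> ground M" using UW W by (auto simp: Z_def)
    fix y assume y: "y \<in> ground M - Z"
    then have "insert y J \<in> indeps M" by (auto simp: Z_def)
    then have "card (insert y J) \<le> rank M (insert y Z)"
      using JZ by (intro card_le_rank[OF M]) auto
    moreover have "card (insert y J) = Suc (card J)"
      using y JZ indep_finite[OF M Ji] by (intro card_insert_disjoint) auto
    ultimately show "rank M Z < rank M (insert y Z)" using rZ by simp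
  qed
  moreover have "Z = \<Union>{C. circuit M C \<and> C \<subseteq> Z}"
  proof (intro equalityI subsetI)
    fix y assume y: "y \<in> Z"
    show "y \<in> \<Union>{C. circuit M C \<and> C \<subseteq> Z}"
    proof (cases "y \<in> U")
      case True
      then obtain C where "circuit M C" "C \<subseteq> W" "y \<in> C" by (auto simp: U_def)
      then show ?thesis using in_U[of C] by (auto simp: Z_def)
    next
      case False
      then have yJ: "y \<in> ground M" "insert y J \<notin> indeps M" using y by (auto simp: Z_def)
      then have "insert y J \<subseteq> ground M" using indep_ground[OF M Ji] by simp
      then obtain C where C: "circuit M C" "C \<subseteq> insert y J"
        using dependent_contains_circuit[OF M _ yJ(2)] by metis
      have "y \<in> C"
      proof (rule ccontr)
        assume "y \<notin> C"
        then have "C \<in> indeps M" using C(2) by (intro indep_subset[OF M Ji]) auto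
        then show False using C(1) by (simp add: circuit_def)
      qed
      moreover have "C \<subseteq> Z" using C(2) JZ y by auto
      ultimately show ?thesis using C(1) by auto
    qed
  qed auto
  then have "\<exists>\<C>. (\<forall>C\<in>\<C>. circuit M C) \<and> Z = \<Union>\<C>"
    by (intro exI[of _ "{C. circuit M C \<and> C \<subseteq> Z}"]) simp
  ultimately have cf: "cyclic_flat M Z" by (simp add: cyclic_flat_def)
  have ind: "J \<union> (W - U) \<in> indeps M"
  proof (rule ccontr)
    assume dep: "J \<union> (W - U) \<notin> indeps M"
    have "J \<union> (W - U) \<subseteq> ground M" using W indep_ground[OF M Ji] by auto
    then obtain C where C: "circuit M C" "C \<subseteq> J \<union> (W - U)"
      using dependent_contains_circuit[OF M _ dep] by metis
    have "C \<subseteq> U" using C JU UW by (intro in_U) auto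
    then have "C \<subseteq> J" using C(2) by auto
    then have "C \<in> indeps M" by (rule indep_subset[OF M Ji])
    then show False using C(1) by (simp add: circuit_def)
  qed
  have finW: "finite W" using W matroid_finite[OF M] by (rule finite_subset)
  have "card J + card (W - Z) = card (J \<union> (W - Z))"
    using JZ finW indep_finite[OF M Ji] by (subst card_Un_disjoint) auto
  also have "\<dots> \<le> rank M W"
    using indep_subset[OF M ind, of "J \<union> (W - Z)"] JU UW by (intro card_le_rank[OF M]) (auto simp: Z_def)
  finally show thesis using that[OF cf] rZ by simp
qed

lemma indep_card_le_rank:
  assumes M: "matroid M" and I: "I \<in> indeps M"
  shows "card (I \<inter> Z) \<le> rank M Z"
  using indep_subset[OF M I] by (intro card_le_rank[OF M]) auto

lemma indep_iff_cyclic_flats: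
  assumes M: "matroid M" and W: "W \<subseteq> ground M"
  shows "W \<in> indeps M \<longleftrightarrow> (\<forall>Z. cyclic_flat M Z \<longrightarrow> card (W \<inter> Z) \<le> rank M Z)"
proof
  assume bound: "\<forall>Z. cyclic_flat M Z \<longrightarrow> card (W \<inter> Z) \<le> rank M Z"
  obtain Z where Z: "cyclic_flat M Z" "rank M Z + card (W - Z) \<le> rank M W"
    using cyclic_flat_rank_bound[OF M W] .
  have fin: "finite W" using W matroid_finite[OF M] by (rule finite_subset)
  obtain K where K: "basis_of M W K" using obtain_basis_of[OF M] .
  have "card W \<le> card K"
    using card_Int_Diff[OF fin, of Z] bound Z rank_eq_card[OF M K] by fastforce
  then have "K = W" using basis_ofD(2)[OF K] fin by (intro card_seteq) auto
  then show "W \<in> indeps M" using basis_ofD(1)[OF K] by simp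
qed (simp add: indep_card_le_rank[OF M])

text \<open>A set is coindependent if and only if its complement has full rank; the rank of the
  complement is attained at some cyclic flat.\<close>

lemma coindep_iff_cyclic_flats:
  assumes M: "matroid M" and W: "W \<subseteq> ground M"
  shows "W \<in> indeps (dual M) \<longleftrightarrow>
    (\<forall>Z. cyclic_flat M Z \<longrightarrow>
      card (W - Z) + rank M (ground M) \<le> card (ground M - Z) + rank M Z)"
proof
  assume "W \<in> indeps (dual M)"
  then obtain B where B: "basis M B" "W \<subseteq> ground M - B" by (auto simp: dual_simps)
  have Bi: "B \<in> indeps M" "finite B" "B \<subseteq> ground M"
    using basis_indep[OF B(1)] indep_finite[OF M] indep_ground[OF M] by simp_all
  have rB: "rank M (ground M) = card B"
    using B(1) basis_eq_basis_of[OF M] rank_eq_card[OF M] by simp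
  have "card (W - Z) + rank M (ground M) \<le> card (ground M - Z) + rank M Z" for Z
  proof -
    have fin: "finite (ground M)" "finite W"
      using matroid_finite[OF M] W by (auto intro: finite_subset)
    have "card (W - Z) + card (B - Z) = card ((W - Z) \<union> (B - Z))"
      using B(2) fin Bi(2) by (subst card_Un_disjoint) auto
    also have "\<dots> \<le> card (ground M - Z)" using W Bi(3) fin by (intro card_mono) auto
    finally show ?thesis
      using rB card_Int_Diff[OF Bi(2), of Z] indep_card_le_rank[OF M Bi(1), of Z] by simp
  qed
  then show "\<forall>Z. cyclic_flat M Z \<longrightarrow>
      card (W - Z) + rank M (ground M) \<le> card (ground M - Z) + rank M Z" by simp
next
  assume bound: "\<forall>Z. cyclic_flat M Z \<longrightarrow>
      card (W - Z) + rank M (ground M) \<le> card (ground M - Z) + rank M Z"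
  have fin: "finite (ground M)" by (rule matroid_finite[OF M])
  obtain Z where Z: "cyclic_flat M Z"
    "rank M Z + card (ground M - W - Z) \<le> rank M (ground M - W)"
    using cyclic_flat_rank_bound[OF M, of "ground M - W"] by auto
  have "card (ground M - Z) = card ((ground M - W - Z) \<union> (W - Z))"
    using W by (intro arg_cong[where f = card]) auto
  also have "\<dots> = card (ground M - W - Z) + card (W - Z)"
    using fin W finite_subset[OF W fin] by (intro card_Un_disjoint) auto
  finally have "rank M (ground M) \<le> rank M (ground M - W)"
    using Z bound by fastforce
  moreover obtain K where K: "basis_of M (ground M - W) K" using obtain_basis_of[OF M] .
  moreover obtain L where L: "basis_of M (ground M) L" using obtain_basis_of[OF M] .
  ultimately have "card L \<le> card K" using rank_eq_card[OF M K] rank_eq_card[OF M L] by simp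
  then have "basis M K"
    using basis_if_card[OF M _ basis_ofD(1)[OF K]] L basis_eq_basis_of[OF M] by blast
  then show "W \<in> indeps (dual M)" using basis_ofD(2)[OF K] W by (auto simp: dual_simps)
qed

section \<open>A family of transversal matroids\<close>

text \<open>Hall's theorem. If \<open>N x\<close> contains two elements \<open>u\<close> and \<open>v\<close>, then one of them can be removed
  without violating Hall's condition: if \<open>insert x S\<close> and \<open>insert x T\<close> were violators after the
  removal of \<open>u\<close> and of \<open>v\<close>, counting the neighbours of \<open>insert x (S \<union> T)\<close> and \<open>S \<inter> T\<close> would give a
  violator before the removal. So the sets can be shrunk to disjoint singletons.\<close>

lemma hall:
  fixes N :: "'a \<Rightarrow> 'b set"
  assumes "finite X" "\<And>x. x \<in> X \<Longrightarrow> finite (N x)"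
    and "\<And>Y. Y \<subseteq> X \<Longrightarrow> card Y \<le> card (\<Union>x\<in>Y. N x)"
  shows "\<exists>\<phi>. inj_on \<phi> X \<and> (\<forall>x\<in>X. \<phi> x \<in> N x)"
  using assms(2,3)
proof (induction "\<Sum>x\<in>X. card (N x)" arbitrary: N rule: less_induct)
  case less
  note finN = less.prems(1) and hallN = less.prems(2)
  have finY: "finite Y" if "Y \<subseteq> X" for Y using that assms(1) by (rule finite_subset)
  show ?case
  proof (cases "\<exists>x\<in>X. \<exists>u\<in>N x. \<exists>v\<in>N x. u \<noteq> v")
    case False
    have ne: "N x \<noteq> {}" if "x \<in> X" for x using hallN[of "{x}"] that finN[OF that] by auto
    define \<phi> where "\<phi> x = (SOME u. u \<in> N x)" for x
    have \<phi>: "\<phi> x \<in> N x" if "x \<in> X" for x using ne[OF that] by (simp add: \<phi>_def some_in_eq)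
    have single: "N x = {\<phi> x}" if "x \<in> X" for x using \<phi>[OF that] False that by blast
    have "inj_on \<phi> X"
    proof (rule inj_onI, rule ccontr)
      fix x y assume xy: "x \<in> X" "y \<in> X" "\<phi> x = \<phi> y" "x \<noteq> y"
      have "card {x, y} \<le> card (\<Union>z\<in>{x, y}. N z)" using xy by (intro hallN) auto
      then show False using xy single by simp
    qed
    then show ?thesis using \<phi> by auto
  next
    case True
    then obtain x u v where x: "x \<in> X" and uv: "u \<in> N x" "v \<in> N x" "u \<noteq> v" by auto
    let ?N = "\<lambda>w. N(x := N x - {w})"
    have violator: "\<exists>S\<subseteq>X - {x}. card ((\<Union>y\<in>S. N y) \<union> (N x - {w})) \<le> card S"
      if w: "w \<in> N x" and no: "\<nexists>\<phi>. inj_on \<phi> X \<and> (\<forall>x\<in>X. \<phi> x \<in> N x)" for w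
    proof -
      have dec: "(\<Sum>y\<in>X. card (?N w y)) < (\<Sum>y\<in>X. card (N y))"
      proof (rule sum_strict_mono_ex1)
        show "\<forall>y\<in>X. card (?N w y) \<le> card (N y)"
          using finN by (auto intro: card_mono)
        show "\<exists>y\<in>X. card (?N w y) < card (N y)"
          using card_Diff1_less[OF finN[OF x] w] by (intro bexI[OF _ x]) (simp only: fun_upd_same)
      qed (rule assms(1))
      have fin': "finite (?N w y)" if "y \<in> X" for y using finN[OF that] x finN by auto
      have "\<not> (\<forall>Y. Y \<subseteq> X \<longrightarrow> card Y \<le> card (\<Union>y\<in>Y. ?N w y))"
      proof
        assume "\<forall>Y. Y \<subseteq> X \<longrightarrow> card Y \<le> card (\<Union>y\<in>Y. ?N w y)"
        then have "\<exists>\<phi>. inj_on \<phi> X \<and> (\<forall>y\<in>X. \<phi> y \<in> ?N w y)"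
          by (intro less.hyps[OF dec fin']) (simp_all del: fun_upd_apply)
        then obtain \<phi> where \<phi>: "inj_on \<phi> X" "\<forall>y\<in>X. \<phi> y \<in> ?N w y" by auto
        then have "\<forall>y\<in>X. \<phi> y \<in> N y" by (auto split: if_splits)
        then show False using no \<phi>(1) by auto
      qed
      then obtain Y where Y: "Y \<subseteq> X" "card (\<Union>y\<in>Y. ?N w y) < card Y" by auto
      have "x \<in> Y"
      proof (rule ccontr)
        assume "x \<notin> Y"
        then have "(\<Union>y\<in>Y. ?N w y) = (\<Union>y\<in>Y. N y)" by (intro SUP_cong) auto
        then show False using hallN[OF Y(1)] Y(2) by simp
      qed
      then have "(\<Union>y\<in>Y. ?N w y) = (\<Union>y\<in>Y - {x}. N y) \<union> (N x - {w})"
        by (auto split: if_splits)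
      moreover have "card Y = Suc (card (Y - {x}))"
        by (rule card_Suc_Diff1[OF finY[OF Y(1)] \<open>x \<in> Y\<close>, symmetric])
      ultimately have "card ((\<Union>y\<in>Y - {x}. N y) \<union> (N x - {w})) \<le> card (Y - {x})" using Y(2) by simp
      then show ?thesis using Y(1) by (intro exI[of _ "Y - {x}"]) auto
    qed
    show ?thesis
    proof (rule ccontr)
      assume no: "\<nexists>\<phi>. inj_on \<phi> X \<and> (\<forall>x\<in>X. \<phi> x \<in> N x)"
      obtain S where S: "S \<subseteq> X - {x}" "card ((\<Union>y\<in>S. N y) \<union> (N x - {u})) \<le> card S"
        using violator[OF uv(1) no] by auto
      obtain T where T: "T \<subseteq> X - {x}" "card ((\<Union>y\<in>T. N y) \<union> (N x - {v})) \<le> card T"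
        using violator[OF uv(2) no] by auto
      let ?P = "(\<Union>y\<in>S. N y) \<union> (N x - {u})" and ?Q = "(\<Union>y\<in>T. N y) \<union> (N x - {v})"
      have fST: "finite S" "finite T" using finY[of S] finY[of T] S(1) T(1) by blast+
      have SX: "y \<in> X" if "y \<in> S" for y using S(1) that by auto
      have TX: "y \<in> X" if "y \<in> T" for y using T(1) that by auto
      have fPQ: "finite ?P" "finite ?Q" using fST finN x SX TX by auto
      have "card (insert x (S \<union> T)) \<le> card (\<Union>y\<in>insert x (S \<union> T). N y)"
        using S(1) T(1) x by (intro hallN) auto
      also have "(\<Union>y\<in>insert x (S \<union> T). N y) = ?P \<union> ?Q" using uv(3) by auto
      also have "card (insert x (S \<union> T)) = Suc (card (S \<union> T))"
        using S(1) T(1) fST by (intro card_insert_disjoint) auto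
      finally have 1: "Suc (card (S \<union> T)) \<le> card (?P \<union> ?Q)" .
      have "card (S \<inter> T) \<le> card (\<Union>y\<in>S \<inter> T. N y)" using S(1) by (intro hallN) auto
      also have "\<dots> \<le> card (?P \<inter> ?Q)" using fPQ by (intro card_mono) auto
      finally have 2: "card (S \<inter> T) \<le> card (?P \<inter> ?Q)" .
      have "card ?P + card ?Q = card (?P \<union> ?Q) + card (?P \<inter> ?Q)"
        by (rule card_Un_Int[OF fPQ])
      moreover have "card S + card T = card (S \<union> T) + card (S \<inter> T)"
        by (rule card_Un_Int[OF fST])
      ultimately show False using 1 2 S(2) T(2) by linarith
    qed
  qed
qed

text \<open>Take \<open>V1\<close>, \<open>V2\<close>, \<open>V3\<close>, \<open>V4\<close> with multiplicities \<open>p\<close>, \<open>q\<close>, \<open>s\<close>, \<open>t\<close>. As every element lies in two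
  of the sets, a set meeting none of two of them lies in the intersection of the other two,
  and Hall's condition for it holds by hypothesis. What remains of Hall's condition are the
  bounds for the whole set and for the sets avoiding one of \<open>V1\<close>, \<open>V2\<close>, \<open>V3\<close>, \<open>V4\<close>.\<close>

lemma transversal_four_sets:
  fixes N :: "'a pre_matroid" and p q s t :: nat
  assumes fin: "finite (ground N)"
    and sub: "V1 \<subseteq> ground N" "V2 \<subseteq> ground N" "V3 \<subseteq> ground N" "V4 \<subseteq> ground N"
    and two: "ground N \<subseteq> V1 \<inter> V2 \<union> V1 \<inter> V3 \<union> V1 \<inter> V4 \<union> V2 \<inter> V3 \<union> V2 \<inter> V4 \<union> V3 \<inter> V4"
    and pairs: "card (V1 \<inter> V2) \<le> p + q" "card (V1 \<inter> V3) \<le> p + s" "card (V1 \<inter> V4) \<le> p + t"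
      "card (V2 \<inter> V3) \<le> q + s" "card (V2 \<inter> V4) \<le> q + t" "card (V3 \<inter> V4) \<le> s + t"
    and indeps: "\<And>W. W \<in> indeps N \<longleftrightarrow> W \<subseteq> ground N \<and> card W \<le> p + q + s + t \<and>
      card (W - V1) \<le> q + s + t \<and> card (W - V2) \<le> p + s + t \<and>
      card (W - V3) \<le> p + q + t \<and> card (W - V4) \<le> p + q + s"
  shows "transversal N"
proof -
  let ?n = "p + q + s + t"
  define \<A> where "\<A> i = (if i < p then V1 else if i < p + q then V2 else if i < p + q + s then V3 else V4)"
    for i
  define I1 I2 I3 I4 where I: "I1 = {..<p}" "I2 = {p..<p + q}" "I3 = {p + q..<p + q + s}" "I4 = {p + q + s..<?n}"
  have cI: "card I1 = p" "card I2 = q" "card I3 = s" "card I4 = t" by (simp_all add: I)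
  have fI: "finite I1" "finite I2" "finite I3" "finite I4" by (simp_all add: I)
  have \<A>I: "x \<in> \<A> i \<longleftrightarrow> (i \<in> I1 \<and> x \<in> V1) \<or> (i \<in> I2 \<and> x \<in> V2) \<or> (i \<in> I3 \<and> x \<in> V3) \<or> (i \<in> I4 \<and> x \<in> V4)"
    if "i < ?n" for i x using that by (auto simp: \<A>_def I)
  have nI: "i < ?n \<longleftrightarrow> i \<in> I1 \<union> I2 \<union> I3 \<union> I4" for i by (auto simp: I)
  have dI: "I1 \<inter> I2 = {}" "I1 \<inter> I3 = {}" "I1 \<inter> I4 = {}" "I2 \<inter> I3 = {}" "I2 \<inter> I4 = {}" "I3 \<inter> I4 = {}"
    by (auto simp: I)
  have "partial_transversal ?n \<A> W \<longleftrightarrow> card W \<le> ?n \<and>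
      card (W - V1) \<le> q + s + t \<and> card (W - V2) \<le> p + s + t \<and>
      card (W - V3) \<le> p + q + t \<and> card (W - V4) \<le> p + q + s" (is "_ \<longleftrightarrow> ?bounds")
    if W: "W \<subseteq> ground N" for W
  proof
    have finW: "finite W" using W fin by (rule finite_subset)
    assume "partial_transversal ?n \<A> W"
    then obtain \<phi> where \<phi>: "matching ?n \<A> \<phi> W" by (auto simp: partial_transversal_iff)
    then have inj: "inj_on \<phi> W" and lt: "\<And>x. x \<in> W \<Longrightarrow> \<phi> x < ?n" and mem: "\<And>x. x \<in> W \<Longrightarrow> x \<in> \<A> (\<phi> x)"
      by (simp_all add: matching_def)
    have le: "card X \<le> card R" if "X \<subseteq> W" "\<phi> ` X \<subseteq> R" "finite R" for X R
      using card_inj_on_le[OF inj_on_subset[OF inj that(1)] that(2,3)] .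
    have at: "(\<phi> x \<in> I1 \<and> x \<in> V1) \<or> (\<phi> x \<in> I2 \<and> x \<in> V2) \<or> (\<phi> x \<in> I3 \<and> x \<in> V3) \<or> (\<phi> x \<in> I4 \<and> x \<in> V4)"
      if "x \<in> W" for x using \<A>I[OF lt[OF that], of x] mem[OF that] by simp
    have "card W \<le> card {..<?n}" using lt by (intro le) auto
    moreover have "card (W - V1) \<le> card (I2 \<union> I3 \<union> I4)" using at fI by (intro le) auto
    moreover have "card (W - V2) \<le> card (I1 \<union> I3 \<union> I4)" using at fI by (intro le) auto
    moreover have "card (W - V3) \<le> card (I1 \<union> I2 \<union> I4)" using at fI by (intro le) auto
    moreover have "card (W - V4) \<le> card (I1 \<union> I2 \<union> I3)" using at fI by (intro le) auto
    ultimately show ?bounds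
      using dI by (simp add: card_Un_disjoint fI cI Int_Un_distrib2)
  next
    assume ?bounds
    then have b: "card W \<le> ?n" "card (W - V1) \<le> q + s + t" "card (W - V2) \<le> p + s + t"
      "card (W - V3) \<le> p + q + t" "card (W - V4) \<le> p + q + s" by simp_all
    have finW: "finite W" using W fin by (rule finite_subset)
    let ?N = "\<lambda>x. {i. i < ?n \<and> x \<in> \<A> i}"
    have "\<exists>\<phi>. inj_on \<phi> W \<and> (\<forall>x\<in>W. \<phi> x \<in> ?N x)"
    proof (rule hall[OF finW])
      fix Y assume Y: "Y \<subseteq> W"
      let ?R = "\<Union>x\<in>Y. ?N x"
      let ?J = "\<lambda>V I. if Y \<inter> V = {} then {} else I :: nat set"
      have finV: "finite V1" "finite V2" "finite V3" "finite V4"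
        using sub fin by (auto intro: finite_subset)
      have hit: "?J V1 I1 \<subseteq> ?R" "?J V2 I2 \<subseteq> ?R" "?J V3 I3 \<subseteq> ?R" "?J V4 I4 \<subseteq> ?R"
        using \<A>I nI by (auto split: if_splits)
      have "finite ?R" using finite_subset[OF Y finW] by simp
      then have "card (?J V1 I1 \<union> ?J V2 I2 \<union> ?J V3 I3 \<union> ?J V4 I4) \<le> card ?R"
        using hit by (intro card_mono) auto
      moreover have "card (?J V1 I1 \<union> ?J V2 I2 \<union> ?J V3 I3 \<union> ?J V4 I4) =
          card (?J V1 I1) + card (?J V2 I2) + card (?J V3 I3) + card (?J V4 I4)"
        using dI fI by (simp add: card_Un_disjoint Int_Un_distrib2)
      ultimately have R: "card (?J V1 I1) + card (?J V2 I2) + card (?J V3 I3) + card (?J V4 I4) \<le> card ?R"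
        by simp
      have le: "card Y \<le> card X" if "Y \<subseteq> X" "finite X" for X using that by (simp add: card_mono)
      have Yg: "Y \<subseteq> ground N" using Y W by auto
      have e0: "card Y \<le> card W" using Y finW by (intro le)
      have e1: "Y \<inter> V1 = {} \<Longrightarrow> card Y \<le> card (W - V1)" "Y \<inter> V2 = {} \<Longrightarrow> card Y \<le> card (W - V2)"
        "Y \<inter> V3 = {} \<Longrightarrow> card Y \<le> card (W - V3)" "Y \<inter> V4 = {} \<Longrightarrow> card Y \<le> card (W - V4)"
        using Y finW by (intro le; blast)+
      have e2: "Y \<inter> V1 = {} \<Longrightarrow> Y \<inter> V2 = {} \<Longrightarrow> card Y \<le> card (V3 \<inter> V4)"
        "Y \<inter> V1 = {} \<Longrightarrow> Y \<inter> V3 = {} \<Longrightarrow> card Y \<le> card (V2 \<inter> V4)"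
        "Y \<inter> V1 = {} \<Longrightarrow> Y \<inter> V4 = {} \<Longrightarrow> card Y \<le> card (V2 \<inter> V3)"
        "Y \<inter> V2 = {} \<Longrightarrow> Y \<inter> V3 = {} \<Longrightarrow> card Y \<le> card (V1 \<inter> V4)"
        "Y \<inter> V2 = {} \<Longrightarrow> Y \<inter> V4 = {} \<Longrightarrow> card Y \<le> card (V1 \<inter> V3)"
        "Y \<inter> V3 = {} \<Longrightarrow> Y \<inter> V4 = {} \<Longrightarrow> card Y \<le> card (V1 \<inter> V2)"
        using Yg two finV by (intro le; blast)+
      have e3: "Y \<inter> V1 = {} \<Longrightarrow> Y \<inter> V2 = {} \<Longrightarrow> Y \<inter> V3 = {} \<Longrightarrow> Y = {}"
        "Y \<inter> V1 = {} \<Longrightarrow> Y \<inter> V2 = {} \<Longrightarrow> Y \<inter> V4 = {} \<Longrightarrow> Y = {}"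
        "Y \<inter> V1 = {} \<Longrightarrow> Y \<inter> V3 = {} \<Longrightarrow> Y \<inter> V4 = {} \<Longrightarrow> Y = {}"
        "Y \<inter> V2 = {} \<Longrightarrow> Y \<inter> V3 = {} \<Longrightarrow> Y \<inter> V4 = {} \<Longrightarrow> Y = {}"
        using Yg two by blast+
      note c1 = order_trans[OF e1(1) b(2)] order_trans[OF e1(2) b(3)]
        order_trans[OF e1(3) b(4)] order_trans[OF e1(4) b(5)]
      note c2 = order_trans[OF e2(1) pairs(6)] order_trans[OF e2(2) pairs(5)]
        order_trans[OF e2(3) pairs(4)] order_trans[OF e2(4) pairs(3)]
        order_trans[OF e2(5) pairs(2)] order_trans[OF e2(6) pairs(1)]
      have "card Y = 0" if "Y = {}" using that by simp
      note c3 = e3[THEN this]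
      \<comment> \<open>\<open>m1\<close> says that \<open>Y\<close> misses \<open>V1\<close>, and so on; the first premise counts the indices of the sets that are met.\<close>
      have arith: "y \<le> r"
        if "(if m1 then 0 else p) + (if m2 then 0 else q) + (if m3 then 0 else s) + (if m4 then 0 else t) \<le> r"
          and "y \<le> p + q + s + t"
          and "m1 \<longrightarrow> y \<le> q + s + t" "m2 \<longrightarrow> y \<le> p + s + t" "m3 \<longrightarrow> y \<le> p + q + t" "m4 \<longrightarrow> y \<le> p + q + s"
          and "m1 \<and> m2 \<longrightarrow> y \<le> s + t" "m1 \<and> m3 \<longrightarrow> y \<le> q + t" "m1 \<and> m4 \<longrightarrow> y \<le> q + s"
          and "m2 \<and> m3 \<longrightarrow> y \<le> p + t" "m2 \<and> m4 \<longrightarrow> y \<le> p + s" "m3 \<and> m4 \<longrightarrow> y \<le> p + q"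
          and "m1 \<and> m2 \<and> m3 \<longrightarrow> y = 0" "m1 \<and> m2 \<and> m4 \<longrightarrow> y = 0"
            "m1 \<and> m3 \<and> m4 \<longrightarrow> y = 0" "m2 \<and> m3 \<and> m4 \<longrightarrow> y = 0"
        for m1 m2 m3 m4 :: bool and y r :: nat
        using that by (cases m1; cases m2; cases m3; cases m4) simp_all
      show "card Y \<le> card ?R"
      proof (rule arith[of "Y \<inter> V1 = {}" "Y \<inter> V2 = {}" "Y \<inter> V3 = {}" "Y \<inter> V4 = {}"])
        show "(if Y \<inter> V1 = {} then 0 else p) + (if Y \<inter> V2 = {} then 0 else q) +
            (if Y \<inter> V3 = {} then 0 else s) + (if Y \<inter> V4 = {} then 0 else t) \<le> card ?R"
          using R unfolding if_distrib[of card] cI card.empty .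
      qed (use order_trans[OF e0 b(1)] c1 c2 c3 in blast)+
    qed simp
    then show "partial_transversal ?n \<A> W" by (auto simp: partial_transversal_def)
  qed
  then have "indeps N = {W. W \<subseteq> ground N \<and> partial_transversal ?n \<A> W}"
    using indeps by blast
  moreover have "\<A> i \<subseteq> ground N" for i using sub by (simp add: \<A>_def)
  ultimately show ?thesis unfolding transversal_def using fin by blast
qed

section \<open>The matroid with six cyclic flats\<close>

text \<open>The hypotheses on \<open>\<alpha>\<close> determine \<open>|C|\<close> and \<open>|F|\<close> from the other four sizes. In this form they
  are visibly invariant under interchanging \<open>D\<close> and \<open>E\<close>, which is the passage to the dual
  matroid.\<close>

locale six_parts =
  fixes A B C D E F :: "'a set"
  assumes fin: "finite A" "finite B" "finite C" "finite D" "finite E" "finite F"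
    and nonempty: "A \<noteq> {}" "B \<noteq> {}" "D \<noteq> {}" "E \<noteq> {}"
    and disjoint: "sorted_wrt disjnt [A, B, C, D, E, F]"
    and card_C: "card C + 1 = card D + card E"
    and card_F: "card F + 1 = card A + card B"
begin

abbreviation "ground_set \<equiv> A \<union> B \<union> C \<union> D \<union> E \<union> F"

lemma part_unique:
  "y \<in> A \<Longrightarrow> y \<notin> B \<and> y \<notin> C \<and> y \<notin> D \<and> y \<notin> E \<and> y \<notin> F"
  "y \<in> B \<Longrightarrow> y \<notin> A \<and> y \<notin> C \<and> y \<notin> D \<and> y \<notin> E \<and> y \<notin> F"
  "y \<in> C \<Longrightarrow> y \<notin> A \<and> y \<notin> B \<and> y \<notin> D \<and> y \<notin> E \<and> y \<notin> F"
  "y \<in> D \<Longrightarrow> y \<notin> A \<and> y \<notin> B \<and> y \<notin> C \<and> y \<notin> E \<and> y \<notin> F"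
  "y \<in> E \<Longrightarrow> y \<notin> A \<and> y \<notin> B \<and> y \<notin> C \<and> y \<notin> D \<and> y \<notin> F"
  "y \<in> F \<Longrightarrow> y \<notin> A \<and> y \<notin> B \<and> y \<notin> C \<and> y \<notin> D \<and> y \<notin> E"
  using disjoint by (auto simp: disjnt_iff)

lemma card_pos: "card A > 0" "card B > 0" "card D > 0" "card E > 0"
  using fin nonempty by (simp_all add: card_gt_0_iff)

lemma card_parts:
  "card (A \<union> B \<union> C) = card A + card B + card C" "card (D \<union> E \<union> F) = card D + card E + card F"
  "card (C \<union> B) = card C + card B" "card (C \<union> A) = card C + card A"
  "card (F \<union> E) = card F + card E" "card (F \<union> D) = card F + card D"
  "card (F \<union> A \<union> D) = card F + card A + card D" "card (F \<union> B \<union> E) = card F + card B + card E"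
  "card (C \<union> B \<union> D) = card C + card B + card D" "card (C \<union> A \<union> E) = card C + card A + card E"
  "card ground_set = card A + card B + card C + card D + card E + card F"
  using fin by (subst card_Un_disjoint; auto dest: part_unique simp: card_Un_disjoint)+

definition indep :: "'a set \<Rightarrow> bool" where
  "indep W \<longleftrightarrow> card W \<le> card A + card B + card C \<and>
     card (W \<inter> (C \<union> B \<union> E)) \<le> card C + card B \<and> card (W \<inter> (C \<union> A \<union> D)) \<le> card C + card A \<and>
     card (W \<inter> (F \<union> E \<union> A)) \<le> card F + card E \<and> card (W \<inter> (F \<union> D \<union> B)) \<le> card F + card D"

lemma indep_single: "indep {x}"
proof -
  have "card ({x} \<inter> Z) \<le> 1" for Z by (rule order_trans[OF card_mono[of "{x}"]]) auto
  then show ?thesis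
    unfolding indep_def using card_pos
    by (auto intro: order_trans[OF \<open>\<And>Z. card ({x} \<inter> Z) \<le> 1\<close>])
qed

text \<open>Take the complements of the four cyclic flats other than the empty and the full one, \<open>|A|\<close>, \<open>|B|\<close>,
  \<open>|D|\<close> and \<open>|E|\<close> times; these are \<open>r + 1\<close> sets, one too many. Each element \<open>x\<close> lies in
  complements of exactly two kinds. Dropping one copy of each of these two kinds and removing
  \<open>x\<close> leaves \<open>r - 1\<close> sets, and they present the contraction by \<open>x\<close>.\<close>

lemma transversal_link:
  assumes x: "x \<in> ground_set" and N: "ground N = ground_set - {x}"
    and ind: "\<And>W. W \<in> indeps N \<longleftrightarrow> W \<subseteq> ground_set - {x} \<and> indep (insert x W)"
  shows "transversal N"
proof -
  define V1 V2 V3 V4 where V: "V1 = F \<union> A \<union> D - {x}" "V2 = F \<union> B \<union> E - {x}"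
    "V3 = C \<union> B \<union> D - {x}" "V4 = C \<union> A \<union> E - {x}"
  define p q s t where pqst: "p = card A - (if x \<in> F \<union> A \<union> D then 1 else 0)"
    "q = card B - (if x \<in> F \<union> B \<union> E then 1 else 0)"
    "s = card D - (if x \<in> C \<union> B \<union> D then 1 else 0)"
    "t = card E - (if x \<in> C \<union> A \<union> E then 1 else 0)"
  have x6: "x \<in> A \<or> x \<in> B \<or> x \<in> C \<or> x \<in> D \<or> x \<in> E \<or> x \<in> F" using x by auto
  have pairs: "V1 \<inter> V2 = F - {x}" "V1 \<inter> V3 = D - {x}" "V1 \<inter> V4 = A - {x}"
    "V2 \<inter> V3 = B - {x}" "V2 \<inter> V4 = E - {x}" "V3 \<inter> V4 = C - {x}"
    unfolding V by (auto dest: part_unique)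
  have pqst': "p + (if x \<in> F \<union> A \<union> D then 1 else 0) = card A"
    "q + (if x \<in> F \<union> B \<union> E then 1 else 0) = card B"
    "s + (if x \<in> C \<union> B \<union> D then 1 else 0) = card D"
    "t + (if x \<in> C \<union> A \<union> E then 1 else 0) = card E"
    using card_pos by (simp_all add: pqst)
  have sizes:
    "p + q + s + t + 1 = card A + card B + card C"
    "q + s + t + (if x \<in> C \<union> B \<union> E then 1 else 0) = card C + card B"
    "p + s + t + (if x \<in> C \<union> A \<union> D then 1 else 0) = card C + card A"
    "p + q + t + (if x \<in> F \<union> E \<union> A then 1 else 0) = card F + card E"
    "p + q + s + (if x \<in> F \<union> D \<union> B then 1 else 0) = card F + card D"
  proof -
    show "p + q + s + t + 1 = card A + card B + card C"
      by (insert x6 pqst' card_C card_F) (elim disjE; frule part_unique; elim conjE; simp)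
    show "q + s + t + (if x \<in> C \<union> B \<union> E then 1 else 0) = card C + card B"
      by (insert x6 pqst' card_C card_F) (elim disjE; frule part_unique; elim conjE; simp)
    show "p + s + t + (if x \<in> C \<union> A \<union> D then 1 else 0) = card C + card A"
      by (insert x6 pqst' card_C card_F) (elim disjE; frule part_unique; elim conjE; simp)
    show "p + q + t + (if x \<in> F \<union> E \<union> A then 1 else 0) = card F + card E"
      by (insert x6 pqst' card_C card_F) (elim disjE; frule part_unique; elim conjE; simp)
    show "p + q + s + (if x \<in> F \<union> D \<union> B then 1 else 0) = card F + card D"
      by (insert x6 pqst' card_C card_F) (elim disjE; frule part_unique; elim conjE; simp)
  qed
  have rem: "card (P - {x}) + (if x \<in> P then 1 else 0) = card P" if "finite P" for P
    using card_Suc_Diff1[OF that, of x] by (cases "x \<in> P") (simp_all del: card_Diff_singleton card_Diff_insert)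
  note rems = fin[THEN rem]
  have le_pairs:
    "card (F - {x}) \<le> p + q" "card (D - {x}) \<le> p + s" "card (A - {x}) \<le> p + t"
    "card (B - {x}) \<le> q + s" "card (E - {x}) \<le> q + t" "card (C - {x}) \<le> s + t"
  proof -
    show "card (F - {x}) \<le> p + q"
      by (insert x6 pqst' rems card_pos card_C card_F)
        (elim disjE; frule part_unique; elim conjE; simp del: card_Diff_singleton card_Diff_insert)
    show "card (D - {x}) \<le> p + s"
      by (insert x6 pqst' rems card_pos card_C card_F)
        (elim disjE; frule part_unique; elim conjE; simp del: card_Diff_singleton card_Diff_insert)
    show "card (A - {x}) \<le> p + t"
      by (insert x6 pqst' rems card_pos card_C card_F)
        (elim disjE; frule part_unique; elim conjE; simp del: card_Diff_singleton card_Diff_insert)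
    show "card (B - {x}) \<le> q + s"
      by (insert x6 pqst' rems card_pos card_C card_F)
        (elim disjE; frule part_unique; elim conjE; simp del: card_Diff_singleton card_Diff_insert)
    show "card (E - {x}) \<le> q + t"
      by (insert x6 pqst' rems card_pos card_C card_F)
        (elim disjE; frule part_unique; elim conjE; simp del: card_Diff_singleton card_Diff_insert)
    show "card (C - {x}) \<le> s + t"
      by (insert x6 pqst' rems card_pos card_C card_F)
        (elim disjE; frule part_unique; elim conjE; simp del: card_Diff_singleton card_Diff_insert)
  qed
  show ?thesis
  proof (rule transversal_four_sets[where ?V1.0 = V1 and ?V2.0 = V2 and ?V3.0 = V3 and ?V4.0 = V4
        and p = p and q = q and s = s and t = t])
    show "finite (ground N)" using fin by (simp add: N)
    show "V1 \<subseteq> ground N" "V2 \<subseteq> ground N" "V3 \<subseteq> ground N" "V4 \<subseteq> ground N"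
      by (auto simp: V N)
    show "ground N \<subseteq> V1 \<inter> V2 \<union> V1 \<inter> V3 \<union> V1 \<inter> V4 \<union> V2 \<inter> V3 \<union> V2 \<inter> V4 \<union> V3 \<inter> V4"
      unfolding pairs N by auto
    show "card (V1 \<inter> V2) \<le> p + q" "card (V1 \<inter> V3) \<le> p + s" "card (V1 \<inter> V4) \<le> p + t"
      "card (V2 \<inter> V3) \<le> q + s" "card (V2 \<inter> V4) \<le> q + t" "card (V3 \<inter> V4) \<le> s + t"
      unfolding pairs by (fact le_pairs)+
    fix W
    have "indep (insert x W) \<longleftrightarrow> card W \<le> p + q + s + t \<and>
        card (W - V1) \<le> q + s + t \<and> card (W - V2) \<le> p + s + t \<and>
        card (W - V3) \<le> p + q + t \<and> card (W - V4) \<le> p + q + s" if W: "W \<subseteq> ground_set - {x}"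
    proof -
      have finW: "finite W" using W fin by (auto intro: finite_subset)
      have xW: "x \<notin> W" using W by auto
      have step: "card (insert x W \<inter> Z) = card (W - V) + (if x \<in> Z then 1 else 0)" if "W \<inter> Z = W - V" for Z V
        using finW xW that by (auto simp: Int_insert_left)
      have "W \<inter> (C \<union> B \<union> E) = W - V1" "W \<inter> (C \<union> A \<union> D) = W - V2"
        "W \<inter> (F \<union> E \<union> A) = W - V3" "W \<inter> (F \<union> D \<union> B) = W - V4"
        unfolding V using W by (auto dest: part_unique)
      note eqs = this[THEN step]
      show ?thesis
        unfolding indep_def eqs card_insert_disjoint[OF finW xW] sizes[symmetric] Suc_eq_plus1
          add_le_cancel_right ..
    qed
    then show "W \<in> indeps N \<longleftrightarrow> W \<subseteq> ground N \<and> card W \<le> p + q + s + t \<and>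
        card (W - V1) \<le> q + s + t \<and> card (W - V2) \<le> p + s + t \<and>
        card (W - V3) \<le> p + q + t \<and> card (W - V4) \<le> p + q + s"
      unfolding ind N by blast
  qed
qed

text \<open>The bases \<open>A \<union> B \<union> C\<close> and \<open>D \<union> E \<union> F\<close> each span two of the four flats. Exchanging an
  element of \<open>A\<close> or \<open>B\<close> for one of \<open>D\<close> or \<open>E\<close> overfills one of these flats in one of the two
  bases. So an exchange bijection would embed \<open>A \<union> B\<close> into \<open>F\<close>, which is too small by one.\<close>

lemma not_base_orderable:
  assumes M: "matroid M" and g: "ground M = ground_set"
    and ind: "\<And>W. W \<subseteq> ground_set \<Longrightarrow> W \<in> indeps M \<longleftrightarrow> indep W"
  shows "\<not> base_orderable M"
proof
  assume "base_orderable M"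
  have le_r: "card I \<le> card A + card B + card C" if "I \<in> indeps M" for I
    using ind[of I] indep_ground[OF M that] that by (simp add: g indep_def)
  obtain B\<^sub>0 where B0: "basis M B\<^sub>0" using basis_extend[OF M empty_indep[OF M]] .
  have basis: "basis M W" if "W \<subseteq> ground_set" "indep W" "card W = card A + card B + card C" for W
    using basis_if_card[OF M B0, of W] le_r[OF basis_indep[OF B0]] ind that by simp
  have int1: "(A \<union> B \<union> C) \<inter> (C \<union> B \<union> E) = C \<union> B" "(A \<union> B \<union> C) \<inter> (C \<union> A \<union> D) = C \<union> A"
    "(A \<union> B \<union> C) \<inter> (F \<union> E \<union> A) = A" "(A \<union> B \<union> C) \<inter> (F \<union> D \<union> B) = B"
    by (auto dest: part_unique)
  have int2: "(D \<union> E \<union> F) \<inter> (C \<union> B \<union> E) = E" "(D \<union> E \<union> F) \<inter> (C \<union> A \<union> D) = D"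
    "(D \<union> E \<union> F) \<inter> (F \<union> E \<union> A) = F \<union> E" "(D \<union> E \<union> F) \<inter> (F \<union> D \<union> B) = F \<union> D"
    by (auto dest: part_unique)
  have "basis M (A \<union> B \<union> C)"
    by (rule basis) (use card_pos card_C card_F in \<open>auto simp: indep_def int1 card_parts\<close>)
  moreover have "basis M (D \<union> E \<union> F)"
    by (rule basis) (use card_pos card_C card_F in \<open>auto simp: indep_def int2 card_parts\<close>)
  ultimately obtain \<sigma> where \<sigma>: "exchange_ordering 1 M (A \<union> B \<union> C) (D \<union> E \<union> F) \<sigma>"
    using \<open>base_orderable M\<close> unfolding base_orderable_def k_base_orderable_def by blast
  then have bij: "bij_betw \<sigma> (A \<union> B \<union> C) (D \<union> E \<union> F)" by (simp add: exchange_ordering_def)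
  have ex: "basis M ((A \<union> B \<union> C - {x}) \<union> {\<sigma> x})" "basis M ((D \<union> E \<union> F - {\<sigma> x}) \<union> {x})"
    if "x \<in> A \<union> B \<union> C" for x
    using \<sigma> that unfolding exchange_ordering_def by (auto dest!: spec[of _ "{x}"])
  \<comment> \<open>If \<open>S\<close> alone attains the bound for \<open>Z\<close>, then \<open>W\<close> has no room for a further element of \<open>Z\<close>.\<close>
  have full: "False"
    if "basis M W" "insert y S \<subseteq> W \<inter> Z" "y \<notin> S" "finite Z" "card (W \<inter> Z) \<le> card S" for W S y Z
  proof -
    have "card (insert y S) \<le> card (W \<inter> Z)" using that by (intro card_mono) auto
    moreover have "finite S" using that(2,4) by (auto intro: finite_subset)
    ultimately show False using that(3,5) by simp
  qed
  have bound: "card (W \<inter> (C \<union> B \<union> E)) \<le> card (C \<union> B)" "card (W \<inter> (C \<union> A \<union> D)) \<le> card (C \<union> A)"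
    "card (W \<inter> (F \<union> E \<union> A)) \<le> card (F \<union> E)" "card (W \<inter> (F \<union> D \<union> B)) \<le> card (F \<union> D)"
    if "basis M W" for W
    using ind[of W] indep_ground[OF M basis_indep[OF that]] basis_indep[OF that]
    by (simp_all add: g indep_def card_parts)
  have "\<sigma> x \<in> F" if x: "x \<in> A \<union> B" for x
  proof (rule ccontr)
    assume nF: "\<sigma> x \<notin> F"
    have xABC: "x \<in> A \<union> B \<union> C" using x by auto
    then have "\<sigma> x \<in> D \<union> E \<union> F" using bij by (auto simp: bij_betw_def)
    then consider "x \<in> A" "\<sigma> x \<in> E" | "x \<in> A" "\<sigma> x \<in> D" | "x \<in> B" "\<sigma> x \<in> D" | "x \<in> B" "\<sigma> x \<in> E"
      using x nF by auto
    then show False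
    proof cases
      case 1
      then show False
        using fin by (intro full[OF ex(1)[OF xABC] _ _ _ bound(1)[OF ex(1)[OF xABC]], of "\<sigma> x"])
          (auto dest: part_unique)
    next
      case 2
      then show False
        using fin by (intro full[OF ex(2)[OF xABC] _ _ _ bound(3)[OF ex(2)[OF xABC]], of x])
          (auto dest: part_unique)
    next
      case 3
      then show False
        using fin by (intro full[OF ex(1)[OF xABC] _ _ _ bound(2)[OF ex(1)[OF xABC]], of "\<sigma> x"])
          (auto dest: part_unique)
    next
      case 4
      then show False
        using fin by (intro full[OF ex(2)[OF xABC] _ _ _ bound(4)[OF ex(2)[OF xABC]], of x])
          (auto dest: part_unique)
    qed
  qed
  then have "\<sigma> ` (A \<union> B) \<subseteq> F" by auto
  moreover have "inj_on \<sigma> (A \<union> B)" using bij by (auto simp: bij_betw_def intro: inj_on_subset)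
  ultimately have "card (A \<union> B) \<le> card F" using fin(6) by (intro card_inj_on_le)
  moreover have "card (A \<union> B) = card A + card B"
    using fin by (intro card_Un_disjoint) (auto dest: part_unique)
  ultimately show False using card_F by simp
qed

end

text \<open>Gammoids are strongly base-orderable, so a class between the gammoids and the base-orderable
  matroids has every matroid as an excluded minor that is not base-orderable and whose proper
  minors are gammoids.\<close>

lemma excluded_minor_between:
  assumes "matroid M" "\<not> base_orderable M" "\<And>N. proper_minor N M \<Longrightarrow> gammoid N"
    and "\<And>N. gammoid N \<Longrightarrow> \<K> N" "\<And>N. \<K> N \<Longrightarrow> base_orderable N"
  shows "excluded_minor \<K> M"
  using assms by (auto simp: excluded_minor_def)

lemma k_base_orderable_if_strongly:
  assumes "strongly_base_orderable M"
  shows "k_base_orderable k M"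
  using assms unfolding strongly_base_orderable_def k_base_orderable_def exchange_ordering_def
  by metis

lemma base_orderable_if_k:
  assumes "k_base_orderable k M" "k \<ge> 1"
  shows "base_orderable M"
  using assms unfolding base_orderable_def k_base_orderable_def exchange_ordering_def
  by (meson order_trans)

theorem theorem8p1:
  fixes r :: nat and A B C D E F :: "'a set" and M :: "'a pre_matroid"
  assumes "r \<ge> 3"
    and "\<forall>S\<in>{A, B, C, D, E, F}. finite S \<and> S \<noteq> {}"
    and "sorted_wrt disjnt [A, B, C, D, E, F]"
    and "r = card (A \<union> B \<union> C)" and "r = card (D \<union> E \<union> F)"
    and "r + 1 = card (A \<union> B \<union> D \<union> E)"
    and "matroid M"
    and "ground M = A \<union> B \<union> C \<union> D \<union> E \<union> F"
    and "{Z. cyclic_flat M Z} =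
           {{}, C \<union> B \<union> E, C \<union> A \<union> D, F \<union> E \<union> A, F \<union> D \<union> B, A \<union> B \<union> C \<union> D \<union> E \<union> F}"
    and "rank M {} = 0"
    and "rank M (C \<union> B \<union> E) = card C + card B"
    and "rank M (C \<union> A \<union> D) = card C + card A"
    and "rank M (F \<union> E \<union> A) = card F + card E"
    and "rank M (F \<union> D \<union> B) = card F + card D"
    and "rank M (A \<union> B \<union> C \<union> D \<union> E \<union> F) = r"
  shows "\<not> base_orderable M \<and>
         (\<forall>x\<in>ground M. transversal (contract M {x})) \<and>
         (\<forall>x\<in>ground M. cotransversal (delete M {x})) \<and>
         excluded_minor gammoid M \<and>
         excluded_minor base_orderable M \<and>
         excluded_minor strongly_base_orderable M \<and>
         (\<forall>k\<ge>1. excluded_minor (k_base_orderable k) M)"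
proof -
  have disj: "A \<inter> B = {}" "(A \<union> B) \<inter> C = {}" "D \<inter> E = {}" "(D \<union> E) \<inter> F = {}"
    "(A \<union> B) \<inter> D = {}" "(A \<union> B \<union> D) \<inter> E = {}"
    using assms(3) by (auto simp: disjnt_iff)
  have fins: "finite A" "finite B" "finite C" "finite D" "finite E" "finite F" using assms(2) by auto
  have r: "r = card A + card B + card C" "r = card D + card E + card F"
    "r + 1 = card A + card B + card D + card E"
    using assms(4,5,6) fins disj by (simp_all add: card_Un_disjoint)
  have nonempty: "A \<noteq> {}" "B \<noteq> {}" "D \<noteq> {}" "E \<noteq> {}" using assms(2) by simp_all
  have sizes: "card C + 1 = card D + card E" "card F + 1 = card A + card B" using r by linarith+
  interpret six_parts A B C D E F
    by (rule six_parts.intro) (fact fins nonempty sizes assms(3))+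
  have disjoint': "sorted_wrt disjnt [A, B, C, E, D, F]" using assms(3) disjnt_sym[of D E] by simp
  \<comment> \<open>This is the data of the dual matroid, as \<open>coind\<close> below shows.\<close>
  interpret dual: six_parts A B C E D F
    by (rule six_parts.intro) (fact fins disjoint' nonempty sizes sizes[unfolded add.commute[of "card D"]])+
  note M = assms(7) and g = assms(8)
  have cf: "cyclic_flat M Z \<longleftrightarrow> Z \<in> {{}, C \<union> B \<union> E, C \<union> A \<union> D, F \<union> E \<union> A, F \<union> D \<union> B, ground_set}" for Z
    using assms(9) by blast
  note ranks = assms(10-15)
  have ind: "W \<in> indeps M \<longleftrightarrow> indep W" if W: "W \<subseteq> ground_set" for W
  proof -
    have "W \<in> indeps M \<longleftrightarrow>
        (\<forall>Z\<in>{{}, C \<union> B \<union> E, C \<union> A \<union> D, F \<union> E \<union> A, F \<union> D \<union> B, ground_set}.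
          card (W \<inter> Z) \<le> rank M Z)"
      using indep_iff_cyclic_flats[OF M, of W] W unfolding g cf by (simp only: Ball_def)
    also have "\<dots> \<longleftrightarrow> indep W"
      unfolding indep_def ball_simps ranks Int_empty_right card.empty Int_absorb2[OF W]
      using r by auto
    finally show ?thesis .
  qed
  have coind: "W \<in> indeps (dual M) \<longleftrightarrow> dual.indep W" if W: "W \<subseteq> ground_set" for W
  proof -
    have diff: "W - (C \<union> B \<union> E) = W \<inter> (F \<union> D \<union> A)" "W - (C \<union> A \<union> D) = W \<inter> (F \<union> E \<union> B)"
      "W - (F \<union> E \<union> A) = W \<inter> (C \<union> B \<union> D)" "W - (F \<union> D \<union> B) = W \<inter> (C \<union> A \<union> E)" "W - ground_set = {}"
      using W by (auto dest: part_unique)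
    have "ground_set - (C \<union> B \<union> E) = F \<union> A \<union> D" "ground_set - (C \<union> A \<union> D) = F \<union> B \<union> E"
      "ground_set - (F \<union> E \<union> A) = C \<union> B \<union> D" "ground_set - (F \<union> D \<union> B) = C \<union> A \<union> E"
      by (auto dest: part_unique)
    note compl = this[THEN arg_cong[where f = card], unfolded card_parts]
    have "W \<in> indeps (dual M) \<longleftrightarrow>
        (\<forall>Z\<in>{{}, C \<union> B \<union> E, C \<union> A \<union> D, F \<union> E \<union> A, F \<union> D \<union> B, ground_set}.
          card (W - Z) + rank M ground_set \<le> card (ground_set - Z) + rank M Z)"
      using coindep_iff_cyclic_flats[OF M, of W] W unfolding g cf by (simp only: Ball_def)
    also have "\<dots> \<longleftrightarrow> dual.indep W"
      unfolding dual.indep_def ball_simps diff compl ranks Diff_empty card_parts Diff_cancel card.empty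
      using r by auto
    finally show ?thesis .
  qed
  have con: "transversal (contract M {x})" if x: "x \<in> ground M" for x
  proof (rule transversal_link)
    show "x \<in> ground_set" using x g by simp
    then have "{x} \<in> indeps M" using ind[of "{x}"] indep_single by simp
    from contract_single_iff[OF M this]
    show "W \<in> indeps (contract M {x}) \<longleftrightarrow> W \<subseteq> ground_set - {x} \<and> indep (insert x W)" for W
      using ind[of "insert x W"] x g by auto
  qed (simp add: g)
  have del: "transversal (dual (delete M {x}))" if x: "x \<in> ground M" for x
  proof (rule dual.transversal_link)
    have G: "A \<union> B \<union> C \<union> E \<union> D \<union> F = ground_set" by auto
    show "x \<in> A \<union> B \<union> C \<union> E \<union> D \<union> F" using x g G by simp
    then have "{x} \<in> indeps (dual M)" using coind[of "{x}"] dual.indep_single G by simp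
    from dual_delete_single_iff[OF M this]
    show "W \<in> indeps (dual (delete M {x})) \<longleftrightarrow>
        W \<subseteq> A \<union> B \<union> C \<union> E \<union> D \<union> F - {x} \<and> dual.indep (insert x W)" for W
      unfolding G using coind[of "insert x W"] x g by auto
    show "ground (dual (delete M {x})) = A \<union> B \<union> C \<union> E \<union> D \<union> F - {x}"
      unfolding G by (simp add: dual_simps g)
  qed
  have nb: "\<not> base_orderable M" by (rule not_base_orderable[OF M g ind])
  have minors: "gammoid N" if "proper_minor N M" for N
    using gammoid_if_proper_minor[OF M _ _ that] con del by simp
  have between: "excluded_minor \<K> M"
    if "\<And>N. gammoid N \<Longrightarrow> \<K> N" "\<And>N. \<K> N \<Longrightarrow> base_orderable N" for \<K> :: "'a pre_matroid \<Rightarrow> bool"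
    by (rule excluded_minor_between[OF M nb minors that])
  note sbo = strongly_base_orderable_if_gammoid
  note bo = base_orderable_if_k[OF k_base_orderable_if_strongly order_refl]
  have "excluded_minor gammoid M" by (rule between) (auto intro: bo sbo)
  moreover have "excluded_minor base_orderable M" by (rule between) (auto intro: bo sbo)
  moreover have "excluded_minor strongly_base_orderable M" by (rule between) (auto intro: bo sbo)
  moreover have "excluded_minor (k_base_orderable k) M" if "k \<ge> 1" for k
    by (rule between) (use that in \<open>auto intro: k_base_orderable_if_strongly sbo base_orderable_if_k\<close>)
  ultimately show ?thesis
    using nb con del matroid_delete[OF M] by (simp add: cotransversal_def)
qed

end
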